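(* Every tournament with minimum outdegree at least $6$ contains three pairwise vertex-disjoint (directed) cycles of pairwise different lengths. Moreover, the bound $6$ is sharp: there exists a tournament with minimum outdegree $5$ that does not contain three pairwise vertex-disjoint cycles of pairwise different lengths.
   Context: A tournament is an orientation of a finite complete graph (exactly one arc between every two distinct vertices). Cycles are directed cycles. *)

theory Defs
  imports Main
begin

definition tournament :: "'a set \<Rightarrow> ('a \<Rightarrow> 'a \<Rightarrow> bool) \<Rightarrow> bool" where
  "tournament V E \<longleftrightarrow> finite V \<and> V \<noteq> {} \<and>
     (\<forall>x y. E x y \<longrightarrow> x \<in> V \<and> y \<in> V \<and> x \<noteq> y) \<and>
     (\<forall>x\<in>V. \<forall>y\<in>V. x \<noteq> y \<longrightarrow> (E x y \<longleftrightarrow> \<not> E y x))"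

definition outdeg :: "'a set \<Rightarrow> ('a \<Rightarrow> 'a \<Rightarrow> bool) \<Rightarrow> 'a \<Rightarrow> nat" where
  "outdeg V E v = card {w \<in> V. E v w}"

definition is_cycle :: "'a set \<Rightarrow> ('a \<Rightarrow> 'a \<Rightarrow> bool) \<Rightarrow> 'a list \<Rightarrow> bool" where
  "is_cycle V E c \<longleftrightarrow> length c \<ge> 2 \<and> distinct c \<and> set c \<subseteq> V \<and>
     (\<forall>i < length c. E (c ! i) (c ! ((i + 1) mod length c)))"

definition three_disjoint_cycles_diff_lengths :: "'a set \<Rightarrow> ('a \<Rightarrow> 'a \<Rightarrow> bool) \<Rightarrow> bool" where
  "three_disjoint_cycles_diff_lengths V E \<longleftrightarrow>
     (\<exists>c1 c2 c3. is_cycle V E c1 \<and> is_cycle V E c2 \<and> is_cycle V E c3 \<and>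
        set c1 \<inter> set c2 = {} \<and> set c1 \<inter> set c3 = {} \<and> set c2 \<inter> set c3 = {} \<and>
        length c1 \<noteq> length c2 \<and> length c1 \<noteq> length c3 \<and> length c2 \<noteq> length c3)"

end

theory Submission
  imports Defs
begin

text \<open>
  Remove a triangle \<open>T\<close> and let \<open>K\<close> be a sink component of the rest: \<open>K\<close> is strong and has minimum
  outdegree at least \<open>3\<close>, hence at least \<open>7\<close> vertices.

  If \<open>K\<close> has \<open>7\<close> or \<open>8\<close> vertices, counting arcs shows that nearly all arcs between \<open>K\<close> and \<open>T\<close>
  point to \<open>T\<close>, so \<open>T\<close> must send many arcs to the set \<open>U\<close> of the remaining vertices, which dominates
  \<open>K\<close>. Besides a 5-cycle inside \<open>K\<close> there are then a 4-cycle and a triangle running through \<open>T\<close>, \<open>U\<close>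
  and \<open>K\<close>.

  If \<open>K\<close> has at least \<open>9\<close> vertices, it contains a disjoint 4-cycle and 5-cycle. Fix a 5-cycle \<open>S\<close>
  in \<open>K\<close>. If \<open>K - S\<close> has no 4-cycle, its strong components are single vertices and triangles, and
  only the last one or two of them matter. Two successive sinks are settled by a finite case
  distinction on the directions of single arcs. Further case distinctions lead from a sink below a
  triangle to two successive sinks, and from a sink triangle to a sink, in the complement of another
  5-cycle.

  The bound is sharp because three such cycles need \<open>3 + 4 + 5 = 12\<close> vertices, while the rotational
  tournament on \<open>11\<close> vertices has all outdegrees equal to \<open>5\<close>.
\<close>

section \<open>Cycles as lists\<close>

definition cycle_arcs :: "'a list \<Rightarrow> ('a \<times> 'a) list" where
  "cycle_arcs c = zip c (rotate1 c)"

lemma map_snd_cycle_arcs [simp]: "map snd (cycle_arcs c) = rotate1 c"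
  by (simp add: cycle_arcs_def)

lemma cycle_arcs_map: "cycle_arcs (map f c) = map (map_prod f f) (cycle_arcs c)"
  by (simp add: cycle_arcs_def rotate1_map zip_map_map map_prod_def)

lemma fst_set_cycle_arcs: "fst ` set (cycle_arcs c) = set c"
  and snd_set_cycle_arcs: "snd ` set (cycle_arcs c) = set c"
  by (simp_all add: cycle_arcs_def flip: set_map)

lemma cycle_arcs_in_set: "(x, y) \<in> set (cycle_arcs c) \<Longrightarrow> x \<in> set c \<and> y \<in> set c"
  by (auto simp: cycle_arcs_def dest: set_zip_leftD set_zip_rightD)

lemma in_set_cycle_arcs_conv_nth:
  "(x, y) \<in> set (cycle_arcs c) \<longleftrightarrow> (\<exists>k<length c. x = c ! k \<and> y = c ! (Suc k mod length c))"
  by (auto simp: cycle_arcs_def in_set_zip nth_rotate1)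

lemma cycle_arcs_irrefl:
  assumes "distinct c" "2 \<le> length c" "(x, y) \<in> set (cycle_arcs c)"
  shows "x \<noteq> y"
proof -
  obtain k where k: "k < length c" "x = c ! k" "y = c ! (Suc k mod length c)"
    using assms(3) by (auto simp: in_set_cycle_arcs_conv_nth)
  then have "Suc k mod length c \<noteq> k" "Suc k mod length c < length c"
    using assms(2) by (auto simp: mod_Suc)
  then show ?thesis
    using k assms(1) by (simp add: nth_eq_iff_index_eq)
qed

lemma majority_contains_arc:
  assumes "distinct c" "A \<subseteq> set c" "length c < 2 * card A"
  shows "\<exists>(x, y)\<in>set (cycle_arcs c). x \<in> A \<and> y \<in> A"
proof (rule ccontr)
  assume none: "\<not> ?thesis"
  define T where "T = {a \<in> set (cycle_arcs c). fst a \<in> A}"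
  have "A \<subseteq> fst ` T"
  proof
    fix x assume "x \<in> A"
    then have "x \<in> fst ` set (cycle_arcs c)"
      unfolding fst_set_cycle_arcs using assms(2) by blast
    then show "x \<in> fst ` T"
      using \<open>x \<in> A\<close> by (auto simp: T_def)
  qed
  then have "card A \<le> card T"
    by (rule surj_card_le[rotated]) (simp add: T_def)
  also have "\<dots> = card (snd ` T)"
  proof -
    have "inj_on snd (set (cycle_arcs c))"
      using assms(1) distinct_map[of snd "cycle_arcs c"] by simp
    then have "inj_on snd T"
      by (rule inj_on_subset) (simp add: T_def)
    then show ?thesis
      by (simp add: card_image)
  qed
  also have "\<dots> \<le> card (set c - A)"
    using none cycle_arcs_in_set by (intro card_mono) (fastforce simp: T_def)+
  also have "\<dots> = length c - card A"
    using assms(1,2) by (simp add: card_Diff_subset distinct_card finite_subset)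
  finally show False
    using assms(3) by simp
qed

lemma is_cycle_iff_arcs:
  "is_cycle V E c \<longleftrightarrow>
     2 \<le> length c \<and> distinct c \<and> set c \<subseteq> V \<and> (\<forall>(x, y)\<in>set (cycle_arcs c). E x y)"
  by (simp add: is_cycle_def cycle_arcs_def all_set_conv_all_nth nth_rotate1)

lemma is_cycle_iff_successively:
  "is_cycle V E c \<longleftrightarrow>
     2 \<le> length c \<and> distinct c \<and> set c \<subseteq> V \<and> successively E c \<and> E (last c) (hd c)"
proof (cases c)
  case (Cons x xs)
  have "(\<forall>i<length c. E (c ! i) (c ! ((i + 1) mod length c))) \<longleftrightarrow>
      E (last c) (hd c) \<and> (\<forall>i<length xs. E (c ! i) (c ! Suc i))"
    unfolding Cons by (simp add: All_less_Suc last_conv_nth)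
  then show ?thesis
    unfolding is_cycle_def successively_conv_nth Cons by auto
qed (simp add: is_cycle_def)

lemma is_cycle_rotate [simp]: "is_cycle V E (rotate n c) \<longleftrightarrow> is_cycle V E c"
proof (induction n)
  case (Suc n)
  have "is_cycle V E (rotate1 d) \<longleftrightarrow> is_cycle V E d" for d
  proof (cases d)
    case (Cons x xs)
    then show ?thesis
      by (cases xs)
        (auto simp: is_cycle_iff_successively successively_append_iff successively_Cons)
  qed simp
  with Suc show ?case
    by simp
qed simp

lemma is_cycle_mono: "is_cycle W E c \<Longrightarrow> W \<subseteq> W' \<Longrightarrow> is_cycle W' E c"
  by (auto simp: is_cycle_def)

lemma card_set_cycle: "is_cycle W E c \<Longrightarrow> card (set c) = length c"
  by (simp add: is_cycle_def distinct_card)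

lemma cycle_starting_at:
  assumes "is_cycle W E c" "x \<in> set c"
  obtains c' where "is_cycle W E (x # c')" "length (x # c') = length c" "set (x # c') = set c"
proof -
  obtain us vs where "c = us @ x # vs"
    using assms(2) by (meson split_list)
  then have "x # vs @ us = rotate (length us) c"
    using rotate_append[of us "x # vs"] by simp
  then show thesis
    using that[of "vs @ us"] assms(1) by (metis is_cycle_rotate length_rotate set_rotate)
qed

lemma cycle_starting_with_arc:
  assumes "is_cycle W E c" "(x, y) \<in> set (cycle_arcs c)"
  obtains c' where "is_cycle W E (x # y # c')" "length (x # y # c') = length c"
    "set (x # y # c') = set c"
proof -
  obtain k where k: "k < length c" "x = c ! k" "y = c ! (Suc k mod length c)"
    using assms(2) by (auto simp: in_set_cycle_arcs_conv_nth)
  have "2 \<le> length (rotate k c)" "c \<noteq> []"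
    using assms(1) by (auto simp: is_cycle_def)
  then obtain u v c' where c': "rotate k c = u # v # c'"
    by (metis Suc_le_length_iff numeral_2_eq_2)
  have "rotate k c ! 0 = x" "rotate k c ! 1 = y"
    using k \<open>2 \<le> length (rotate k c)\<close> \<open>c \<noteq> []\<close> nth_rotate[of 0 c k] nth_rotate[of 1 c k]
    by simp_all
  then have "rotate k c = x # y # c'"
    using c' by simp
  then show thesis
    using that[of c'] assms(1) by (metis is_cycle_rotate length_rotate set_rotate)
qed

lemma is_cycle_insert:
  assumes "is_cycle W E (y # us @ z # vs)" "v \<in> W - set (y # us @ z # vs)"
    and "E z v" "E v (hd (vs @ [y]))"
  shows "is_cycle W E (y # us @ z # v # vs)"
  using assms by (cases vs)
    (auto simp: is_cycle_iff_successively successively_append_iff successively_Cons hd_append)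

section \<open>Strong tournaments\<close>

definition strong :: "('a \<Rightarrow> 'a \<Rightarrow> bool) \<Rightarrow> 'a set \<Rightarrow> bool" where
  "strong E W \<longleftrightarrow> W \<noteq> {} \<and> (\<forall>A. A \<noteq> {} \<and> A \<subset> W \<longrightarrow> (\<exists>a\<in>A. \<exists>b\<in>W - A. E a b))"

lemma strong_nonempty: "strong E W \<Longrightarrow> W \<noteq> {}"
  by (simp add: strong_def)

lemma strong_leave: "strong E W \<Longrightarrow> A \<noteq> {} \<Longrightarrow> A \<subset> W \<Longrightarrow> \<exists>a\<in>A. \<exists>b\<in>W - A. E a b"
  unfolding strong_def by blast

locale tournament_graph =
  fixes V :: "'a set" and E :: "'a \<Rightarrow> 'a \<Rightarrow> bool"
  assumes tournament: "tournament V E"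
begin

lemma finite_V: "finite V"
  and V_nonempty: "V \<noteq> {}"
  and arc_total: "x \<in> V \<Longrightarrow> y \<in> V \<Longrightarrow> x \<noteq> y \<Longrightarrow> E x y \<or> E y x"
  and arc_asym: "E x y \<Longrightarrow> \<not> E y x"
  and arc_irrefl: "\<not> E x x"
  using tournament unfolding tournament_def by (blast+)

lemma finite_subset_V: "W \<subseteq> V \<Longrightarrow> finite W"
  using finite_V finite_subset by blast

lemma length_cycle_ge_3:
  assumes "is_cycle W E c"
  shows "3 \<le> length c"
proof (rule ccontr)
  assume "\<not> 3 \<le> length c"
  then have "length c = 2"
    using assms by (simp add: is_cycle_def)
  then obtain x y where "c = [x, y]"
    by (auto simp: numeral_2_eq_2 length_Suc_conv)
  then show False
    using assms arc_asym by (auto simp: is_cycle_iff_successively)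
qed

lemma strong_triangle:
  assumes "strong E W" "W \<subseteq> V" "v \<in> W" "W \<noteq> {v}"
  obtains c where "is_cycle W E c" "length c = 3"
proof -
  let ?A = "{w \<in> W. E v w}"
  obtain a where "a \<in> W" "E v a"
    using strong_leave[OF assms(1), of "{v}"] assms by blast
  moreover have "?A \<subset> W"
    using assms(3) arc_irrefl by blast
  ultimately obtain x y where xy: "x \<in> ?A" "y \<in> W - ?A" "E x y"
    using strong_leave[OF assms(1), of ?A] by blast
  then have "y \<noteq> v"
    using arc_asym by blast
  then have "E y v"
    using xy assms(2,3) arc_total by blast
  then have "is_cycle W E [v, x, y]"
    using xy assms(3) arc_irrefl by (auto simp: is_cycle_iff_successively)
  then show thesis
    by (rule that) simp
qed

lemma cycle_insert_or_uniform:
  assumes c: "is_cycle W E c" and v: "v \<in> W - set c" and "W \<subseteq> V"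
  obtains d where "is_cycle W E d" "length d = Suc (length c)"
  | "\<forall>x\<in>set c. E v x" | "\<forall>x\<in>set c. E x v"
proof (cases "(\<forall>x\<in>set c. E v x) \<or> (\<forall>x\<in>set c. E x v)")
  case False
  have flip: "E x v \<longleftrightarrow> \<not> E v x" if "x \<in> set c" for x
    using that assms arc_total[of x v] arc_asym by (auto simp: is_cycle_def)
  then obtain x y where xy: "x \<in> set c" "E x v" "y \<in> set c" "E v y"
    using False by blast
  obtain c' where c': "is_cycle W E (y # c')" "length (y # c') = length c" "set (y # c') = set c"
    using c xy(3) by (rule cycle_starting_at)
  have "x \<noteq> y"
    using xy arc_asym by blast
  then have "x \<in> set c'"
    using xy(1) c'(3) by (metis set_ConsD)
  then have "\<exists>z\<in>set c'. E z v"
    using xy(2) by blast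
  then obtain us z vs where z: "c' = us @ z # vs" "E z v" "\<forall>w\<in>set vs. \<not> E w v"
    by (rule split_list_last_propE)
  have "E v (hd (vs @ [y]))"
    using z xy(4) flip[of "hd vs"] unfolding c'(3)[symmetric] by (cases vs) auto
  moreover have "v \<in> W - set (y # us @ z # vs)"
    using v c'(3) z(1) by simp
  ultimately have "is_cycle W E (y # us @ z # v # vs)"
    using c'(1) z(1,2) by (intro is_cycle_insert) simp_all
  then show ?thesis
    by (rule that(1)) (use c'(2) z(1) in simp)
qed (use that in blast)

lemma strong_detour:
  assumes "strong E W" "C \<subset> W" "C \<noteq> {}"
    and uniform: "\<And>v. v \<in> W - C \<Longrightarrow> (\<forall>c\<in>C. E v c) \<or> (\<forall>c\<in>C. E c v)"
  obtains x y where "x \<in> W - C" "y \<in> W - C" "E x y" "\<forall>c\<in>C. E c x" "\<forall>c\<in>C. E y c"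
proof -
  let ?O = "{v \<in> W - C. \<forall>c\<in>C. E c v}" and ?I = "{v \<in> W - C. \<forall>c\<in>C. E v c}"
  have cover: "W - C = ?O \<union> ?I"
    using uniform by blast
  have "?I \<noteq> {}"
  proof
    assume "?I = {}"
    then have "?O = W - C"
      using cover by blast
    moreover have "W - C \<noteq> {}" "W - C \<subset> W"
      using assms(2,3) by blast+
    then obtain a b where "a \<in> W - C" "b \<in> C" "E a b"
      using strong_leave[OF assms(1), of "W - C"] by blast
    ultimately show False
      using arc_asym by blast
  qed
  then have "C \<union> ?O \<subset> W"
    using assms(2,3) arc_asym by blast
  then obtain a b where ab: "a \<in> C \<union> ?O" "b \<in> W - (C \<union> ?O)" "E a b"
    using strong_leave[OF assms(1), of "C \<union> ?O"] assms(3) by blast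
  then have "b \<in> ?I"
    using cover by blast
  then show thesis
    using that[of a b] ab arc_asym by blast
qed

lemma strong_longer_cycle:
  assumes "strong E W" "W \<subseteq> V" "is_cycle W E c" "set c \<noteq> W"
  shows "\<exists>d. is_cycle W E d \<and> length d = Suc (length c)"
proof (rule ccontr)
  assume none: "\<nexists>d. is_cycle W E d \<and> length d = Suc (length c)"
  have uniform: "(\<forall>x\<in>set c. E v x) \<or> (\<forall>x\<in>set c. E x v)" if "v \<in> W - set c" for v
    using cycle_insert_or_uniform[OF assms(3) that assms(2)] none by blast
  have "set c \<subset> W" "set c \<noteq> {}"
    using assms(3,4) by (auto simp: is_cycle_def)
  then obtain x y where xy: "x \<in> W - set c" "y \<in> W - set c" "E x y"
      "\<forall>v\<in>set c. E v x" "\<forall>v\<in>set c. E y v"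
    using uniform by (rule strong_detour[OF assms(1)])
  obtain a b c' where c: "c = a # b # c'"
    using assms(3) by (cases c rule: remdups_adj.cases) (auto simp: is_cycle_def)
  have "is_cycle W E (x # y # b # c')"
    using xy assms(3) arc_irrefl c by (auto simp: is_cycle_iff_successively)
  then show False
    using none c by (metis length_Cons)
qed

theorem strong_cycle_of_length:
  assumes "strong E W" "W \<subseteq> V" "3 \<le> k" "k \<le> card W"
  obtains c where "is_cycle W E c" "length c = k"
proof -
  have "\<exists>c. is_cycle W E c \<and> length c = k"
    using assms(3,4)
  proof (induction k rule: dec_induct)
    case base
    obtain v where "v \<in> W"
      using assms(1) strong_nonempty by blast
    moreover have "W \<noteq> {v}"
      using base by auto
    ultimately show ?case
      by (metis strong_triangle[OF assms(1,2)])
  next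
    case (step k)
    then obtain c where c: "is_cycle W E c" "length c = k"
      by auto
    then have "card (set c) \<noteq> card W"
      using step.prems by (simp add: card_set_cycle)
    then have "set c \<noteq> W"
      by blast
    with c show ?case
      using strong_longer_cycle[OF assms(1,2), of c] by simp
  qed
  then show thesis
    using that by blast
qed

lemma sink_component:
  assumes "X \<subseteq> V" "X \<noteq> {}"
  obtains W where "W \<subseteq> X" "strong E W" "\<And>w x. w \<in> W \<Longrightarrow> x \<in> X - W \<Longrightarrow> E x w"
proof -
  define closed where "closed = {W. W \<subseteq> X \<and> W \<noteq> {} \<and> (\<forall>w\<in>W. \<forall>x\<in>X - W. \<not> E w x)}"
  have "finite closed"
    using finite_subset_V[OF assms(1)] by (simp add: closed_def)
  moreover have "X \<in> closed"
    using assms(2) by (simp add: closed_def)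
  ultimately obtain W where W: "W \<in> closed"
    and minimal: "\<And>A. A \<in> closed \<Longrightarrow> A \<subseteq> W \<Longrightarrow> W = A"
    using finite_has_minimal[of closed] by blast
  have "strong E W"
    unfolding strong_def
  proof (intro conjI allI impI)
    fix A assume A: "A \<noteq> {} \<and> A \<subset> W"
    then have "A \<notin> closed"
      using minimal by blast
    then show "\<exists>a\<in>A. \<exists>b\<in>W - A. E a b"
      using A W unfolding closed_def by blast
  qed (use W in \<open>simp add: closed_def\<close>)
  moreover have "E x w" if "w \<in> W" "x \<in> X - W" for w x
    using that W assms(1) arc_total[of w x] unfolding closed_def by blast
  ultimately show thesis
    using that[of W] W by (simp add: closed_def)
qed

lemma sink_vertex_or_sink_triangle:
  assumes "A \<subseteq> V" "A \<noteq> {}" and no_4_cycle: "\<And>c. is_cycle A E c \<Longrightarrow> length c \<noteq> 4"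
  obtains y where "y \<in> A" "\<forall>x\<in>A - {y}. E x y"
  | T where "is_cycle A E T" "length T = 3" "\<forall>x\<in>A - set T. \<forall>t\<in>set T. E x t"
proof -
  obtain W where W: "W \<subseteq> A" "strong E W" "\<And>w x. w \<in> W \<Longrightarrow> x \<in> A - W \<Longrightarrow> E x w"
    using sink_component[OF assms(1,2)] by metis
  then have WV: "W \<subseteq> V"
    using assms(1) by blast
  obtain y where y: "y \<in> W"
    using W(2) strong_nonempty by blast
  show thesis
  proof (cases "W = {y}")
    case True
    then show ?thesis
      using that(1)[of y] W by blast
  next
    case False
    then obtain T where T: "is_cycle W E T" "length T = 3"
      using strong_triangle[OF W(2) WV y] by metis
    have "\<not> 4 \<le> card W"
    proof
      assume "4 \<le> card W"
      then obtain c where "is_cycle W E c" "length c = 4"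
        using strong_cycle_of_length[OF W(2) WV, of 4] by auto
      then show False
        using no_4_cycle is_cycle_mono[OF _ W(1)] by blast
    qed
    moreover have "set T \<subseteq> W" "card (set T) = 3"
      using T card_set_cycle[OF T(1)] by (simp_all add: is_cycle_def)
    ultimately have "set T = W"
      using finite_subset_V[OF WV] by (intro card_seteq) auto
    then show ?thesis
      using that(2)[of T] T W is_cycle_mono by blast
  qed
qed

end

section \<open>Degrees in tournaments\<close>

definition indeg :: "'a set \<Rightarrow> ('a \<Rightarrow> 'a \<Rightarrow> bool) \<Rightarrow> 'a \<Rightarrow> nat" where
  "indeg W E v = card {w \<in> W. E w v}"

lemma outdeg_le_card: "finite W \<Longrightarrow> outdeg W E v \<le> card W"
  unfolding outdeg_def by (intro card_mono) auto

context tournament_graph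
begin

lemma outdeg_plus_indeg:
  assumes "W \<subseteq> V" "v \<in> V - W"
  shows "outdeg W E v + indeg W E v = card W"
proof -
  have "outdeg W E v + indeg W E v = card ({w \<in> W. E v w} \<union> {w \<in> W. E w v})"
    unfolding outdeg_def indeg_def
    using finite_subset_V[OF assms(1)] arc_asym by (subst card_Un_disjoint) auto
  also have "{w \<in> W. E v w} \<union> {w \<in> W. E w v} = W"
    using assms arc_total[of v] by auto
  finally show ?thesis .
qed

lemma sum_outdeg_eq_sum_indeg:
  assumes "A \<subseteq> V" "B \<subseteq> V"
  shows "(\<Sum>a\<in>A. outdeg B E a) = (\<Sum>b\<in>B. indeg A E b)"
  using sum.swap_restrict[of A B "\<lambda>_ _. 1::nat" E] assms finite_subset_V
  by (simp add: outdeg_def indeg_def)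

lemma sum_outdeg:
  assumes "W \<subseteq> V"
  shows "2 * (\<Sum>v\<in>W. outdeg W E v) = card W * (card W - 1)"
proof -
  have "2 * (\<Sum>v\<in>W. outdeg W E v) = (\<Sum>v\<in>W. outdeg W E v + indeg W E v)"
    using sum_outdeg_eq_sum_indeg[OF assms assms] by (simp add: sum.distrib)
  also have "\<dots> = (\<Sum>v\<in>W. card W - 1)"
  proof (rule sum.cong)
    fix v assume "v \<in> W"
    moreover have "{w \<in> W. E v w} = {w \<in> W - {v}. E v w}" "{w \<in> W. E w v} = {w \<in> W - {v}. E w v}"
      using arc_irrefl by blast+
    then have "outdeg W E v = outdeg (W - {v}) E v" "indeg W E v = indeg (W - {v}) E v"
      by (simp_all only: outdeg_def indeg_def)
    ultimately show "outdeg W E v + indeg W E v = card W - 1"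
      using outdeg_plus_indeg[of "W - {v}" v] assms by auto
  qed simp
  finally show ?thesis
    by simp
qed

lemma outdeg_le_sink_component:
  assumes "A \<subseteq> V" "K \<subseteq> V" "\<And>x. x \<in> V - A - K \<Longrightarrow> E x k"
  shows "outdeg V E k \<le> outdeg K E k + outdeg A E k"
proof -
  have "w \<in> K \<union> A" if "w \<in> V" "E k w" for w
    using that assms(3)[of w] arc_asym by auto
  then have "{w \<in> V. E k w} = {w \<in> K. E k w} \<union> {w \<in> A. E k w}"
    using assms(1,2) by blast
  then show ?thesis
    unfolding outdeg_def using card_Un_le by metis
qed

end

section \<open>Certificates for disjoint cycles of lengths 4 and 5\<close>

definition disjoint_cycles_4_5 :: "'a set \<Rightarrow> ('a \<Rightarrow> 'a \<Rightarrow> bool) \<Rightarrow> bool" where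
  "disjoint_cycles_4_5 W E \<longleftrightarrow>
     (\<exists>c d. is_cycle W E c \<and> is_cycle W E d \<and> length c = 4 \<and> length d = 5 \<and> set c \<inter> set d = {})"

lemma disjoint_cycles_4_5I:
  assumes "is_cycle W E c" "is_cycle W E d" "length c = 4" "length d = 5" "set c \<inter> set d = {}"
  shows "disjoint_cycles_4_5 W E"
  unfolding disjoint_cycles_4_5_def using assms by blast

fun successive_sinks :: "('a \<Rightarrow> 'a \<Rightarrow> bool) \<Rightarrow> 'a set \<Rightarrow> 'a list \<Rightarrow> bool" where
  "successive_sinks E X [] \<longleftrightarrow> True"
| "successive_sinks E X (y # ys) \<longleftrightarrow>
     y \<in> X \<and> (\<forall>x\<in>X - {y}. E x y) \<and> successive_sinks E (X - {y}) ys"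

text \<open>
  Certificates describe the vertices of a tournament on \<open>K\<close> by a list \<open>xs\<close> of length \<open>n\<close>: the
  index \<open>i < n\<close> stands for \<open>xs ! i\<close>, the index \<open>n\<close> for the whole set \<open>K - set xs\<close>. An arc \<open>(i, j)\<close>
  means that every vertex of part \<open>i\<close> has an out-neighbour in part \<open>j\<close>, so that one of \<open>(i, j)\<close>
  and \<open>(j, i)\<close> always holds.

  The arcs of a pattern cannot all hold unless \<open>K\<close> contains a disjoint 4-cycle and 5-cycle: \<open>Cycles\<close>
  exhibits them, \<open>Sinks d ys\<close> makes \<open>ys\<close> successive sinks of the complement of the 5-cycle \<open>d\<close>, and
  \<open>Outs v ws\<close> confines the out-neighbours of \<open>v\<close> to \<open>ws\<close>. Here \<open>F\<close> is the set of those numbers of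
  successive sinks that are already known to suffice. If all arcs of a pattern but one are known,
  the remaining one is therefore reversed. A certificate consists of such inferences and of case
  distinctions on the direction of an arc.
\<close>

datatype pattern =
    Cycles "nat list" "nat list"
  | Sinks "nat list" "nat list"
  | Outs nat "nat list"

fun sink_arcs :: "nat list \<Rightarrow> nat list \<Rightarrow> (nat \<times> nat) list" where
  "sink_arcs ws [] = []"
| "sink_arcs ws (y # ys) = map (\<lambda>w. (w, y)) (removeAll y ws) @ sink_arcs (removeAll y ws) ys"

fun arcs :: "nat \<Rightarrow> pattern \<Rightarrow> (nat \<times> nat) list" where
  "arcs n (Cycles c d) = cycle_arcs c @ cycle_arcs d"
| "arcs n (Sinks d ys) = cycle_arcs d @ sink_arcs (filter (\<lambda>w. w \<notin> set d) [0..<Suc n]) ys"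
| "arcs n (Outs v ws) = map (\<lambda>w. (w, v)) (filter (\<lambda>w. w \<notin> set (v # ws)) [0..<Suc n])"

fun well_formed :: "nat \<Rightarrow> nat set \<Rightarrow> pattern \<Rightarrow> bool" where
  "well_formed n F (Cycles c d) \<longleftrightarrow>
     length c = 4 \<and> length d = 5 \<and> distinct (c @ d) \<and> (\<forall>i\<in>set (c @ d). i \<le> n)"
| "well_formed n F (Sinks d ys) \<longleftrightarrow>
     length d = 5 \<and> length ys \<in> F \<and> distinct (d @ ys) \<and> (\<forall>i\<in>set (d @ ys). i < n)"
| "well_formed n F (Outs v ws) \<longleftrightarrow> v < n \<and> length ws < 3 \<and> n \<notin> set ws"

datatype certificate =
    Close "pattern list"
  | Split "pattern list" nat nat certificate certificate

fun infer :: "nat \<Rightarrow> nat set \<Rightarrow> (nat \<times> nat) list \<Rightarrow> pattern list \<Rightarrow> (nat \<times> nat) list option" where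
  "infer n F A [] = Some A"
| "infer n F A (p # ps) =
     (if well_formed n F p then
        case filter (\<lambda>a. a \<notin> set A) (arcs n p) of
          [] \<Rightarrow> None
        | (i, j) # as \<Rightarrow> if as = [] \<and> i \<noteq> j then infer n F ((j, i) # A) ps else infer n F A ps
      else infer n F A ps)"

fun certifies :: "nat \<Rightarrow> nat set \<Rightarrow> (nat \<times> nat) list \<Rightarrow> certificate \<Rightarrow> bool" where
  "certifies n F A (Close ps) \<longleftrightarrow> infer n F A ps = None"
| "certifies n F A (Split ps i j s t) \<longleftrightarrow>
     (case infer n F A ps of
        None \<Rightarrow> True
      | Some B \<Rightarrow> i \<noteq> j \<and> certifies n F ((i, j) # B) s \<and> certifies n F ((j, i) # B) t)"

locale subtournament_outdeg_3 = tournament_graph +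
  fixes K :: "'a set"
  assumes K_subset_V: "K \<subseteq> V"
    and outdeg_ge_3: "v \<in> K \<Longrightarrow> 3 \<le> outdeg K E v"
begin

lemma finite_K: "finite K"
  using K_subset_V by (rule finite_subset_V)

end

locale indexed_parts = subtournament_outdeg_3 +
  fixes xs :: "'a list" and F :: "nat set"
  assumes distinct_xs: "distinct xs"
    and xs_subset_K: "set xs \<subseteq> K"
    and successive_sinks_suffice: "is_cycle K E d \<Longrightarrow> length d = 5 \<Longrightarrow> length ys \<in> F \<Longrightarrow>
      successive_sinks E (K - set d) ys \<Longrightarrow> disjoint_cycles_4_5 K E"
begin

definition part :: "nat \<Rightarrow> 'a set" where
  "part i = (if i < length xs then {xs ! i} else if i = length xs then K - set xs else {})"

definition part_arc :: "nat \<times> nat \<Rightarrow> bool" where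
  "part_arc = (\<lambda>(i, j). \<forall>u\<in>part i. \<exists>v\<in>part j. E u v)"

lemma part_arcD: "part_arc (i, j) \<Longrightarrow> u \<in> part i \<Longrightarrow> \<exists>v\<in>part j. E u v"
  by (simp add: part_arc_def)

lemma part_lt: "i < length xs \<Longrightarrow> part i = {xs ! i}"
  and part_length: "part (length xs) = K - set xs"
  by (simp_all add: part_def)

lemma part_subset: "part i \<subseteq> K"
  using xs_subset_K by (auto simp: part_def)

lemma part_disjoint: "i \<noteq> j \<Longrightarrow> part i \<inter> part j = {}"
  using distinct_xs by (auto simp: part_def nth_eq_iff_index_eq split: if_splits)

lemma UN_part_Diff: "(\<Union>i\<in>I. part i) - (\<Union>i\<in>J. part i) = (\<Union>i\<in>I - J. part i)"
proof -
  have "i = j" if "x \<in> part i" "x \<in> part j" for x i j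
    using that part_disjoint by blast
  then show ?thesis
    by blast
qed

lemma K_eq_UN_part: "K = (\<Union>i\<le>length xs. part i)"
proof -
  have "set xs = (\<Union>i<length xs. part i)"
    by (auto simp: part_lt in_set_conv_nth)
  then show ?thesis
    using xs_subset_K by (auto simp: part_length lessThan_Suc lessThan_Suc_atMost[symmetric])
qed

lemma part_arc_total:
  assumes "i \<noteq> j"
  shows "part_arc (i, j) \<or> part_arc (j, i)"
proof (rule ccontr)
  assume "\<not> ?thesis"
  then obtain u v where uv: "u \<in> part i" "\<forall>w\<in>part j. \<not> E u w" "v \<in> part j" "\<forall>w\<in>part i. \<not> E v w"
    by (auto simp: part_arc_def)
  then have "u \<noteq> v"
    using part_disjoint[OF assms] by blast
  moreover have "u \<in> V" "v \<in> V"
    using uv(1,3) part_subset K_subset_V by blast+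
  ultimately show False
    using arc_total uv by blast
qed

lemma is_cycle_representatives:
  assumes "2 \<le> length c" "distinct c" "\<forall>i\<in>set c. f i \<in> part i"
    and "\<forall>(i, j)\<in>set (cycle_arcs c). E (f i) (f j)"
  shows "is_cycle K E (map f c)"
proof -
  have "inj_on f (set c)"
    using assms(3) part_disjoint by (intro inj_onI) (metis IntI emptyE)
  moreover have "f ` set c \<subseteq> K"
    using assms(3) part_subset by blast
  ultimately show ?thesis
    using assms by (auto simp: is_cycle_iff_arcs distinct_map cycle_arcs_map)
qed

lemma last_part_representative:
  assumes "\<forall>a\<in>set A. part_arc a" "distinct (map snd A)"
    and index: "\<And>i j. (i, j) \<in> set A \<Longrightarrow> i \<noteq> j \<and> i \<le> length xs"
  obtains p where "\<And>i. (i, length xs) \<in> set A \<Longrightarrow> p \<in> part (length xs) \<and> E (xs ! i) p"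
proof (cases "\<exists>i. (i, length xs) \<in> set A")
  case True
  then obtain i where i: "(i, length xs) \<in> set A" ..
  then have "i < length xs"
    using index[OF i] by simp
  then obtain p where "p \<in> part (length xs)" "E (xs ! i) p"
    using assms(1) i part_arcD[of i "length xs" "xs ! i"] by (auto simp: part_lt)
  moreover have "i' = i" if "(i', length xs) \<in> set A" for i'
    using inj_onD[of snd "set A" "(i', length xs)" "(i, length xs)"] that i assms(2)
    by (simp add: distinct_map)
  ultimately show thesis
    using that by blast
qed (use that in blast)

lemma representatives:
  assumes A: "\<forall>a\<in>set A. part_arc a" "distinct (map snd A)" "fst ` set A = snd ` set A"
    and index: "\<And>i j. (i, j) \<in> set A \<Longrightarrow> i \<noteq> j \<and> i \<le> length xs"
  obtains f where "\<forall>i\<in>fst ` set A. f i \<in> part i" "\<forall>(i, j)\<in>set A. E (f i) (f j)"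
proof -
  let ?n = "length xs"
  obtain p where p: "\<And>i. (i, ?n) \<in> set A \<Longrightarrow> p \<in> part ?n \<and> E (xs ! i) p"
    using last_part_representative[OF A(1,2) index] by metis
  define f where "f i = (if i < ?n then xs ! i else p)" for i
  have f_part: "f i \<in> part i" if "i \<in> fst ` set A" for i
  proof -
    obtain j k where "(i, j) \<in> set A" "(k, i) \<in> set A"
      using \<open>i \<in> fst ` set A\<close> A(3) by force
    then show ?thesis
      using index[of i j] p[of k] by (cases "i = ?n") (auto simp: f_def part_lt)
  qed
  moreover have "E (f i) (f j)" if ij: "(i, j) \<in> set A" for i j
  proof -
    have i: "i \<noteq> j" "i \<le> ?n" "i \<in> fst ` set A"
      using index[OF ij] ij by force+
    obtain k where "(j, k) \<in> set A"
      using ij A(3) by force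
    then have "j \<le> ?n"
      using index by blast
    moreover obtain v where "v \<in> part j" "E (f i) v"
      using ij A(1) f_part[OF i(3)] part_arcD by blast
    ultimately show ?thesis
      using i p[of i] ij by (cases "j = ?n") (auto simp: f_def part_lt)
  qed
  ultimately show thesis
    by (intro that[of f]) auto
qed

lemma Cycles_sound:
  assumes "well_formed (length xs) F (Cycles c d)"
    and "\<forall>a\<in>set (arcs (length xs) (Cycles c d)). part_arc a"
  shows "disjoint_cycles_4_5 K E"
proof -
  have part_arcs: "\<forall>a\<in>set (cycle_arcs c @ cycle_arcs d). part_arc a"
    using assms(2) by simp
  have cd: "length c = 4" "length d = 5" "distinct c" "distinct d" "set c \<inter> set d = {}"
    "\<forall>i\<in>set c \<union> set d. i \<le> length xs"
    using assms(1) by auto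
  have index: "i \<noteq> j \<and> i \<le> length xs" if "(i, j) \<in> set (cycle_arcs c @ cycle_arcs d)" for i j
    using that cd cycle_arcs_irrefl[of c i j] cycle_arcs_irrefl[of d i j]
      cycle_arcs_in_set[of i j c] cycle_arcs_in_set[of i j d] by auto
  have "distinct (map snd (cycle_arcs c @ cycle_arcs d))"
    using cd by simp
  moreover have "fst ` set (cycle_arcs c @ cycle_arcs d) = set c \<union> set d"
      "snd ` set (cycle_arcs c @ cycle_arcs d) = set c \<union> set d"
    by (simp_all add: image_Un fst_set_cycle_arcs snd_set_cycle_arcs)
  ultimately obtain f where f: "\<forall>i\<in>set c \<union> set d. f i \<in> part i"
    "\<forall>(i, j)\<in>set (cycle_arcs c @ cycle_arcs d). E (f i) (f j)"
    using representatives[OF part_arcs _ _ index] by metis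
  have "is_cycle K E (map f c)" "is_cycle K E (map f d)"
    using cd f by (auto intro!: is_cycle_representatives)
  moreover have "f i \<noteq> f j" if "i \<in> set c" "j \<in> set d" for i j
    using that f(1) cd(5) part_disjoint[of i j] by (metis IntI UnCI empty_iff)
  then have "set (map f c) \<inter> set (map f d) = {}"
    by auto
  ultimately show ?thesis
    using cd(1,2) by (intro disjoint_cycles_4_5I[of K E "map f c" "map f d"]) simp_all
qed

lemma successive_sinks_parts:
  assumes "\<forall>a\<in>set (sink_arcs ws ys). part_arc a"
    and "distinct ys" "set ys \<subseteq> set ws" "\<forall>y\<in>set ys. y < length xs"
  shows "successive_sinks E (\<Union>i\<in>set ws. part i) (map ((!) xs) ys)"
  using assms
proof (induction ys arbitrary: ws)
  case (Cons y ys)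
  have y: "part y = {xs ! y}" "y \<in> set ws"
    using Cons.prems by (auto simp: part_lt)
  then have remove_y: "(\<Union>i\<in>set ws. part i) - {xs ! y} = (\<Union>i\<in>set (removeAll y ws). part i)"
    using UN_part_Diff[of "set ws" "{y}"] by simp
  have "E x (xs ! y)" if x: "x \<in> (\<Union>i\<in>set (removeAll y ws). part i)" for x
  proof -
    obtain i where "i \<in> set (removeAll y ws)" "x \<in> part i"
      using x by blast
    then show ?thesis
      using Cons.prems(1) y(1) part_arcD[of i y x] by simp
  qed
  moreover have "successive_sinks E (\<Union>i\<in>set (removeAll y ws). part i) (map ((!) xs) ys)"
    by (rule Cons.IH) (use Cons.prems in auto)
  ultimately show ?case
    using y by (auto simp: remove_y)
qed simp

lemma Sinks_sound:
  assumes "well_formed (length xs) F (Sinks d ys)"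
    and "\<forall>a\<in>set (arcs (length xs) (Sinks d ys)). part_arc a"
  shows "disjoint_cycles_4_5 K E"
proof -
  let ?ws = "filter (\<lambda>w. w \<notin> set d) [0..<Suc (length xs)]"
  have part_arcs: "\<forall>a\<in>set (cycle_arcs d). part_arc a" "\<forall>a\<in>set (sink_arcs ?ws ys). part_arc a"
    using assms(2) by (simp_all del: upt_Suc)
  have d: "length d = 5" "distinct d" "\<forall>i\<in>set d. i < length xs"
    and ys: "length ys \<in> F" "distinct ys" "\<forall>y\<in>set ys. y < length xs" "set ys \<subseteq> set ?ws"
    using assms(1) by auto
  have "E (xs ! i) (xs ! j)" if ij: "(i, j) \<in> set (cycle_arcs d)" for i j
    using part_arcs(1) ij d(3) cycle_arcs_in_set[OF ij] part_arcD[of i j "xs ! i"]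
    by (simp add: part_lt)
  then have "is_cycle K E (map ((!) xs) d)"
    using d by (intro is_cycle_representatives) (auto simp: part_lt)
  moreover have "K - set (map ((!) xs) d) = (\<Union>i\<in>set ?ws. part i)"
  proof -
    have "set (map ((!) xs) d) = (\<Union>i\<in>set d. part i)"
      using d(3) by (auto simp: part_lt)
    moreover have "set ?ws = {..length xs} - set d"
      by (auto simp: less_Suc_eq_le simp del: upt_Suc)
    ultimately show ?thesis
      using K_eq_UN_part UN_part_Diff[of "{..length xs}" "set d"] by simp
  qed
  ultimately show ?thesis
    using successive_sinks_suffice[of "map ((!) xs) d" "map ((!) xs) ys"] d(1) ys(1)
      successive_sinks_parts[OF part_arcs(2) ys(2,4,3)] by simp
qed

lemma Outs_not_all_part_arcs:
  assumes "well_formed (length xs) F (Outs v ws)"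
  shows "\<exists>a\<in>set (arcs (length xs) (Outs v ws)). \<not> part_arc a"
proof (rule ccontr)
  assume "\<not> ?thesis"
  then have part_arcs: "part_arc (i, v)" if "i \<le> length xs" "i \<noteq> v" "i \<notin> set ws" for i
    using that by (auto simp: less_Suc_eq_le simp del: upt_Suc)
  have v: "part v = {xs ! v}" and ws: "length ws < 3" "length xs \<notin> set ws"
    using assms by (auto simp: part_lt)
  have "{w \<in> K. E (xs ! v) w} \<subseteq> (!) xs ` set ws"
  proof
    fix w assume w: "w \<in> {w \<in> K. E (xs ! v) w}"
    then obtain i where i: "i \<le> length xs" "w \<in> part i"
      using K_eq_UN_part by blast
    moreover have "i \<noteq> v"
      using i(2) w v arc_irrefl by auto
    moreover have "\<not> part_arc (i, v)"
      using part_arcD[of i v w] i(2) w v arc_asym by auto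
    ultimately have "i \<in> set ws"
      using part_arcs by blast
    then show "w \<in> (!) xs ` set ws"
      using i ws(2) by (auto simp: part_def split: if_splits)
  qed
  then have "outdeg K E (xs ! v) \<le> card ((!) xs ` set ws)"
    unfolding outdeg_def by (rule card_mono[rotated]) simp
  also have "\<dots> \<le> length ws"
    by (rule le_trans[OF card_image_le[OF finite_set] card_length])
  finally show False
    using outdeg_ge_3[of "xs ! v"] part_subset[of v] v ws(1) by simp
qed

lemma pattern_sound:
  assumes "well_formed (length xs) F p" "\<forall>a\<in>set (arcs (length xs) p). part_arc a"
  shows "disjoint_cycles_4_5 K E"
  using assms Cycles_sound Sinks_sound Outs_not_all_part_arcs by (cases p) blast+

lemma infer_sound:
  assumes "\<not> disjoint_cycles_4_5 K E" "\<forall>a\<in>set A. part_arc a"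
  shows "\<exists>B. infer (length xs) F A ps = Some B \<and> (\<forall>a\<in>set B. part_arc a)"
  using assms(2)
proof (induction ps arbitrary: A)
  case (Cons p ps)
  let ?unknown = "filter (\<lambda>a. a \<notin> set A) (arcs (length xs) p)"
  show ?case
  proof (cases "well_formed (length xs) F p")
    case True
    then obtain a where "a \<in> set (arcs (length xs) p)" and a: "\<not> part_arc a"
      using pattern_sound assms(1) by blast
    then have "a \<in> set ?unknown"
      using Cons.prems by auto
    then obtain i j as where unknown: "?unknown = (i, j) # as"
      by (cases ?unknown) auto
    then have "part_arc (j, i)" if "as = []" "i \<noteq> j"
      using part_arc_total[OF that(2)] \<open>a \<in> set ?unknown\<close> a that(1) by auto
    then show ?thesis
      using True unknown Cons by simp
  next
    case False
    then show ?thesis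
      using Cons by simp
  qed
qed simp

theorem certificate_sound:
  assumes "\<forall>a\<in>set A. part_arc a" "certifies (length xs) F A t"
  shows "disjoint_cycles_4_5 K E"
proof (rule ccontr)
  assume none: "\<not> ?thesis"
  then have "\<not> certifies (length xs) F A t"
    using assms(1)
  proof (induction t arbitrary: A)
    case (Close ps)
    then show ?case
      using infer_sound[of A ps] by auto
  next
    case (Split ps i j s t)
    then obtain B where "infer (length xs) F A ps = Some B" "\<forall>a\<in>set B. part_arc a"
      using infer_sound by blast
    then show ?case
      using Split.IH[of "(i, j) # B"] Split.IH[of "(j, i) # B"] none part_arc_total[of i j] by auto
  qed
  then show False
    using assms(2) by blast
qed

end

section \<open>Disjoint cycles of lengths 4 and 5\<close>

text \<open>
  In all three configurations the indices \<open>0, \<dots>, 4\<close> form a 5-cycle \<open>S\<close> and the largest index is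
  the set of the remaining vertices. In \<open>two_sinks_arcs\<close> the complement of \<open>S\<close> has the successive
  sinks \<open>8\<close> and \<open>7\<close>; in \<open>sink_vertex_arcs\<close> it has the sink \<open>8\<close>, and \<open>5, 6, 7\<close> is a triangle that
  becomes a sink component once \<open>8\<close> is removed; in \<open>sink_triangle_arcs\<close> it has the sink component
  \<open>5, 6, 7\<close>. The certificates were found by computer search.
\<close>

definition two_sinks_arcs :: "(nat \<times> nat) list" where
  "two_sinks_arcs = cycle_arcs [0, 1, 2, 3, 4] @ [(0, 5), (5, 6)] @
     sink_arcs [5, 6, 7, 8, 9] [8, 7]"

definition sink_vertex_arcs :: "(nat \<times> nat) list" where
  "sink_vertex_arcs = cycle_arcs [0, 1, 2, 3, 4] @ cycle_arcs [5, 6, 7] @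
     [(8, 0), (8, 1), (9, 5), (9, 6), (9, 7)] @ sink_arcs [5, 6, 7, 8, 9] [8]"

definition sink_triangle_arcs :: "(nat \<times> nat) list" where
  "sink_triangle_arcs = cycle_arcs [0, 1, 2, 3, 4] @ cycle_arcs [5, 6, 7] @
     [(5, 0), (8, 5), (8, 6), (8, 7)]"

definition two_sinks_certificate :: certificate where
  "two_sinks_certificate =
    Split [] 4 8
     (Split [] 1 8
      (Split [Outs 8 [2, 3], Outs 8 [0, 3], Outs 8 [0, 2], Cycles [1, 2, 3, 4] [0, 5, 6, 7, 8]] 4 7
       (Split [Cycles [0, 5, 6, 8] [1, 2, 3, 4, 7]] 7 2
        (Close [Cycles [2, 3, 4, 7] [0, 5, 6, 1, 8], Cycles [2, 3, 4, 7] [0, 1, 5, 6, 8],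
           Cycles [2, 3, 4, 7] [0, 5, 1, 6, 8]])
        (Close [Outs 7 [3, 8], Cycles [2, 3, 4, 8] [0, 5, 6, 1, 7],
           Cycles [2, 3, 4, 8] [0, 1, 5, 6, 7], Cycles [2, 3, 4, 8] [0, 5, 1, 6, 7]]))
       (Split [Cycles [2, 3, 1, 8] [4, 0, 5, 6, 7], Cycles [8, 2, 3, 9] [4, 0, 5, 6, 7]] 3 5
        (Close [Cycles [0, 1, 4, 8] [2, 3, 5, 6, 7], Cycles [3, 5, 6, 8] [4, 0, 1, 2, 7]])
        (Split [] 1 5
         (Close [Cycles [2, 6, 7, 8] [3, 4, 0, 1, 5], Cycles [2, 3, 6, 8] [4, 0, 1, 5, 7],
            Outs 3 [0, 4], Cycles [2, 3, 4, 6] [0, 1, 5, 7, 8],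
            Cycles [2, 3, 7, 8] [4, 0, 1, 5, 6]])
         (Close [Cycles [2, 6, 7, 8] [1, 3, 4, 0, 5], Cycles [1, 4, 0, 5] [2, 3, 6, 7, 8],
            Outs 3 [0, 4], Cycles [2, 3, 7, 8] [1, 4, 0, 5, 6], Cycles [0, 5, 1, 8] [4, 6, 2, 3, 7],
            Cycles [2, 3, 7, 8] [4, 0, 5, 1, 6]]))))
      (Split [Cycles [0, 5, 6, 7] [1, 2, 3, 4, 8]] 5 2
       (Split [Cycles [1, 6, 7, 8] [2, 3, 4, 0, 5], Cycles [7, 8, 1, 9] [2, 3, 4, 0, 5]] 3 7
        (Split [Cycles [4, 0, 5, 6] [1, 2, 3, 7, 8], Cycles [0, 5, 7, 8] [1, 2, 3, 4, 6],
           Outs 8 [1, 3], Outs 8 [1, 2], Cycles [2, 3, 7, 8] [1, 4, 0, 5, 6]] 7 1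
         (Close [Outs 1 [2, 3], Cycles [1, 5, 6, 7] [2, 3, 4, 0, 8]])
         (Close [Outs 7 [4, 8], Outs 7 [2, 8], Cycles [3, 7, 4, 8] [1, 2, 0, 5, 6],
            Cycles [2, 6, 1, 7] [3, 4, 0, 5, 8], Cycles [1, 7, 2, 9] [3, 4, 0, 5, 8],
            Outs 2 [3, 4]]))
        (Split [Cycles [1, 2, 6, 8] [3, 4, 0, 5, 7], Cycles [8, 1, 2, 9] [3, 4, 0, 5, 7]] 2 7
         (Close [Cycles [1, 2, 7, 8] [3, 4, 0, 5, 6], Cycles [3, 6, 2, 7] [1, 4, 0, 5, 8],
            Cycles [4, 0, 5, 7] [1, 2, 3, 6, 8], Cycles [0, 5, 6, 8] [3, 4, 1, 2, 7], Outs 7 [3, 8],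
            Outs 1 [2, 3], Outs 8 [1, 2], Cycles [3, 4, 0, 8] [1, 5, 6, 2, 7]])
         (Split [Cycles [1, 5, 6, 8] [2, 3, 4, 0, 7]] 8 2
          (Close [Outs 2 [3, 4], Cycles [1, 3, 4, 8] [2, 0, 5, 6, 7],
             Cycles [2, 0, 5, 6] [1, 7, 3, 4, 8], Outs 1 [2, 4]])
          (Close [Outs 8 [1, 3], Outs 8 [0, 1], Cycles [1, 2, 3, 4] [0, 5, 6, 7, 8],
             Cycles [1, 2, 3, 9] [0, 5, 6, 7, 8], Cycles [2, 3, 5, 6] [1, 4, 0, 7, 8],
             Cycles [2, 3, 6, 7] [1, 4, 0, 5, 8], Outs 3 [0, 4],
             Cycles [1, 7, 2, 8] [3, 4, 0, 5, 6], Outs 1 [2, 4]]))))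
       (Split [Cycles [3, 4, 0, 7] [1, 2, 5, 6, 8], Cycles [4, 0, 5, 6] [1, 2, 3, 7, 8]] 7 4
        (Close [Cycles [4, 0, 3, 7] [1, 2, 5, 6, 8], Cycles [4, 0, 5, 7] [1, 2, 3, 6, 8],
           Cycles [1, 2, 5, 8] [4, 6, 3, 0, 7]])
        (Close [Outs 7 [2, 8], Cycles [0, 5, 6, 8] [1, 2, 3, 4, 7],
           Cycles [3, 4, 0, 8] [1, 2, 5, 6, 7], Outs 8 [1, 2]]))))
     (Split [] 7 1
      (Split [Cycles [4, 0, 5, 8] [1, 2, 3, 6, 7], Cycles [1, 2, 3, 7] [4, 0, 5, 6, 8],
         Cycles [7, 1, 2, 9] [4, 0, 5, 6, 8], Cycles [4, 0, 5, 8] [7, 1, 2, 3, 9]] 8 2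
       (Split [] 2 7
        (Close [Cycles [1, 2, 7, 8] [3, 4, 0, 5, 6], Cycles [2, 7, 1, 8] [3, 4, 0, 5, 6]])
        (Split [] 6 2
         (Split [] 2 5
          (Split [Cycles [0, 1, 3, 4] [2, 5, 6, 7, 8], Cycles [2, 5, 7, 8] [3, 4, 0, 1, 6],
             Cycles [2, 5, 6, 8] [3, 4, 0, 1, 9], Cycles [4, 0, 7, 8] [3, 1, 2, 5, 6],
             Cycles [7, 8, 4, 9] [3, 1, 2, 5, 6]] 1 4
           (Close [Cycles [0, 3, 1, 4] [2, 5, 6, 7, 8], Cycles [0, 1, 2, 3] [4, 5, 6, 7, 8],
              Cycles [2, 5, 7, 8] [3, 0, 1, 4, 6], Cycles [2, 5, 6, 8] [3, 0, 1, 4, 7],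
              Outs 4 [0, 2]])
           (Close [Outs 1 [2, 5], Cycles [0, 5, 6, 7] [2, 3, 4, 1, 8]]))
          (Split [Outs 2 [3, 4], Outs 2 [0, 3], Cycles [7, 3, 4, 9] [2, 0, 5, 6, 8]] 6 4
           (Split [] 4 7
            (Close [Cycles [2, 0, 5, 8] [1, 6, 3, 4, 7], Cycles [3, 4, 7, 8] [1, 2, 0, 5, 6],
               Cycles [4, 7, 3, 8] [1, 2, 0, 5, 6]])
            (Close [Outs 4 [0, 5], Outs 4 [0, 1], Cycles [1, 2, 3, 4] [0, 5, 6, 7, 8],
               Cycles [2, 0, 1, 8] [3, 4, 5, 6, 7], Cycles [1, 2, 0, 8] [3, 4, 5, 6, 7]]))
           (Close [Cycles [3, 4, 6, 8] [1, 2, 0, 5, 7], Cycles [4, 6, 3, 8] [1, 2, 0, 5, 7]])))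
         (Close [Cycles [1, 2, 6, 8] [3, 4, 0, 5, 7], Cycles [3, 4, 0, 5] [2, 6, 7, 1, 8],
            Cycles [4, 0, 1, 8] [2, 3, 5, 6, 7]])))
       (Split [Cycles [3, 5, 6, 7] [4, 0, 1, 2, 8]] 3 8
        (Close [Outs 8 [1, 4], Outs 8 [0, 4], Cycles [1, 2, 3, 8] [4, 0, 5, 6, 7],
           Cycles [0, 5, 6, 8] [1, 2, 3, 4, 7]])
        (Close [Outs 3 [1, 4], Outs 3 [0, 4], Cycles [3, 1, 2, 8] [4, 0, 5, 6, 7],
           Cycles [3, 0, 5, 6] [4, 7, 1, 2, 8]])))
      (Split [] 7 2
       (Split [Cycles [2, 3, 1, 7] [4, 0, 5, 6, 8], Cycles [7, 2, 3, 9] [4, 0, 5, 6, 8]] 6 3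
        (Split [] 8 2
         (Split [Cycles [0, 1, 3, 4] [2, 5, 6, 7, 8], Cycles [7, 8, 2, 9] [3, 4, 0, 5, 6]] 2 6
          (Close [Cycles [2, 6, 7, 8] [1, 3, 4, 0, 5], Cycles [3, 5, 2, 6] [4, 0, 1, 7, 8],
             Cycles [2, 6, 7, 8] [3, 4, 0, 1, 5]])
          (Split [Outs 2 [3, 4], Outs 2 [0, 3], Cycles [3, 4, 5, 6] [2, 0, 1, 7, 8]] 3 8
           (Close [Cycles [4, 1, 3, 8] [2, 0, 5, 6, 7], Cycles [3, 8, 4, 9] [2, 0, 5, 6, 7],
              Outs 4 [0, 7], Cycles [4, 6, 3, 8] [2, 0, 5, 1, 7],
              Cycles [4, 6, 3, 8] [2, 0, 1, 5, 7]])
           (Close [Cycles [2, 0, 5, 6] [3, 4, 1, 7, 8], Cycles [2, 0, 5, 6] [7, 8, 3, 4, 9],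
              Outs 4 [0, 7], Cycles [3, 4, 6, 8] [2, 0, 5, 1, 7],
              Cycles [3, 4, 6, 8] [2, 0, 1, 5, 7]])))
         (Split [Cycles [1, 7, 2, 8] [3, 4, 0, 5, 6], Cycles [4, 0, 1, 8] [2, 3, 5, 6, 7],
            Outs 8 [3, 4], Outs 8 [0, 4], Cycles [0, 5, 6, 8] [2, 3, 4, 1, 7], Outs 3 [4, 7],
            Outs 3 [0, 4], Cycles [2, 5, 6, 7] [3, 4, 0, 1, 8],
            Cycles [3, 7, 2, 8] [1, 4, 0, 5, 6]] 1 5
          (Close [Cycles [3, 7, 2, 8] [4, 0, 1, 5, 6], Cycles [4, 6, 7, 8] [2, 3, 0, 1, 5]])
          (Close [Cycles [3, 7, 2, 8] [4, 0, 5, 1, 6], Cycles [1, 3, 0, 5] [4, 6, 7, 2, 8]])))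
        (Close [Cycles [4, 0, 5, 8] [2, 3, 6, 1, 7], Cycles [2, 3, 6, 7] [4, 0, 1, 5, 8],
           Cycles [2, 3, 5, 7] [4, 0, 1, 6, 8], Cycles [2, 3, 6, 7] [4, 0, 5, 1, 8],
           Cycles [1, 6, 7, 8] [2, 3, 4, 0, 5], Cycles [3, 4, 0, 5] [1, 6, 7, 2, 8],
           Cycles [0, 1, 3, 4] [2, 5, 6, 7, 8]]))
       (Split [] 7 3
        (Split [Cycles [3, 1, 2, 7] [4, 0, 5, 6, 8]] 8 1
         (Close [Cycles [1, 2, 7, 8] [3, 4, 0, 5, 6], Cycles [1, 2, 6, 8] [3, 4, 0, 5, 7],
            Cycles [1, 2, 3, 6] [4, 0, 5, 7, 8], Cycles [2, 3, 5, 6] [4, 0, 1, 7, 8],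
            Cycles [3, 4, 0, 5] [1, 6, 2, 7, 8]])
         (Split [] 8 2
          (Split [Cycles [2, 5, 6, 8] [3, 4, 0, 1, 7]] 6 2
           (Split [Cycles [2, 3, 5, 6] [4, 0, 1, 7, 8]] 6 3
            (Split [Cycles [7, 8, 2, 9] [3, 4, 0, 5, 6], Cycles [2, 7, 3, 9] [4, 0, 5, 6, 8],
               Outs 3 [4, 8], Outs 3 [0, 4], Cycles [3, 0, 5, 6] [4, 1, 2, 7, 8], Outs 8 [2, 4],
               Cycles [2, 7, 3, 8] [1, 4, 0, 5, 6]] 1 5
             (Close [Cycles [2, 7, 3, 8] [4, 0, 1, 5, 6], Cycles [0, 1, 5, 8] [3, 4, 6, 2, 7]])
             (Close [Cycles [2, 7, 3, 8] [4, 0, 5, 1, 6], Cycles [2, 3, 4, 6] [0, 5, 1, 7, 8]]))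
            (Close [Cycles [3, 6, 2, 7] [4, 0, 5, 1, 8], Cycles [3, 6, 2, 7] [4, 0, 1, 5, 8]]))
           (Close [Cycles [2, 6, 7, 8] [1, 3, 4, 0, 5], Cycles [4, 0, 1, 8] [3, 5, 2, 6, 7],
              Cycles [2, 6, 7, 8] [3, 4, 0, 1, 5]]))
          (Split [Outs 8 [3, 4], Cycles [0, 5, 6, 8] [3, 4, 1, 2, 7],
             Cycles [0, 1, 2, 8] [3, 4, 5, 6, 7]] 1 5
           (Close [Cycles [3, 4, 2, 7] [0, 1, 5, 6, 8], Cycles [7, 3, 4, 9] [0, 1, 5, 6, 8],
              Outs 4 [0, 7], Cycles [3, 4, 6, 7] [0, 1, 5, 2, 8],
              Cycles [3, 4, 6, 7] [0, 1, 2, 5, 8]])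
           (Close [Cycles [3, 4, 6, 7] [0, 5, 1, 2, 8], Cycles [7, 3, 4, 9] [0, 5, 1, 2, 8],
              Outs 4 [0, 7], Cycles [3, 4, 2, 7] [0, 5, 6, 1, 8],
              Cycles [3, 4, 2, 7] [0, 5, 1, 6, 8]]))))
        (Split [Outs 7 [4, 8], Outs 7 [0, 8], Cycles [4, 5, 6, 8] [0, 1, 2, 3, 7]] 8 1
         (Close [Cycles [1, 2, 7, 8] [3, 4, 0, 5, 6], Cycles [4, 0, 5, 7] [1, 2, 3, 6, 8]])
         (Split [] 8 2
          (Close [Cycles [0, 5, 6, 7] [2, 3, 4, 1, 8], Cycles [0, 5, 6, 7] [8, 2, 3, 4, 9],
             Outs 4 [0, 2], Cycles [0, 5, 1, 7] [2, 3, 4, 6, 8],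
             Cycles [0, 1, 5, 7] [2, 3, 4, 6, 8]])
          (Split [Outs 8 [3, 4], Outs 8 [0, 4], Cycles [1, 2, 3, 4] [0, 5, 6, 7, 8]] 9 4
           (Close [Outs 4 [0, 6], Outs 4 [0, 2], Cycles [3, 4, 6, 8] [0, 5, 1, 2, 7],
              Cycles [4, 2, 3, 7] [0, 1, 5, 6, 8]])
           (Close [Cycles [8, 3, 4, 9] [0, 5, 1, 2, 7], Cycles [8, 3, 4, 9] [0, 1, 5, 6, 7]])))))))"

definition sink_vertex_certificate :: certificate where
  "sink_vertex_certificate =
    Split [] 3 6
     (Split [] 5 4
      (Split [Cycles [5, 4, 0, 7] [1, 2, 3, 6, 8], Cycles [5, 4, 0, 9] [1, 2, 3, 6, 8],
         Cycles [7, 5, 4, 9] [1, 2, 3, 6, 8]] 2 7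
       (Close [Sinks [0, 1, 2, 7, 8] [4, 6], Sinks [0, 1, 2, 7, 8] [6, 4]])
       (Split [Cycles [2, 3, 6, 7] [5, 8, 0, 1, 9]] 0 5
        (Close [Cycles [1, 2, 3, 4] [0, 5, 6, 7, 8], Cycles [2, 3, 6, 7] [1, 4, 0, 5, 8]])
        (Close [Sinks [1, 2, 3, 6, 8] [0, 4], Cycles [2, 3, 4, 7] [0, 1, 5, 6, 8],
           Sinks [2, 3, 6, 4, 7] [1, 0], Sinks [2, 3, 4, 6, 7] [1, 0]])))
      (Split [] 0 7
       (Split [Cycles [1, 2, 3, 4] [0, 7, 5, 6, 8], Cycles [2, 3, 6, 7] [0, 1, 4, 5, 8]] 5 2
        (Close [Cycles [2, 3, 4, 5] [0, 1, 6, 7, 8], Cycles [0, 1, 4, 8] [5, 2, 3, 6, 7],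
           Cycles [1, 2, 3, 6] [4, 0, 7, 5, 8]])
        (Close [Cycles [3, 4, 0, 7] [1, 2, 5, 6, 8], Sinks [0, 1, 4, 5, 8] [7, 6],
           Cycles [2, 5, 3, 6] [1, 4, 0, 7, 8], Cycles [2, 3, 5, 6] [1, 4, 0, 7, 8]]))
       (Split [] 0 9
        (Close [Cycles [7, 8, 0, 9] [2, 3, 4, 5, 6], Cycles [1, 2, 3, 8] [5, 6, 7, 0, 9],
           Cycles [3, 4, 5, 8] [0, 1, 2, 6, 7]])
        (Close [Sinks [1, 2, 3, 6, 8] [0, 5], Sinks [1, 2, 3, 6, 8] [5, 0]]))))
     (Split [] 9 2
      (Split [] 2 0
       (Split [] 4 1
        (Close [Cycles [1, 2, 3, 4] [0, 5, 6, 7, 8], Cycles [1, 2, 3, 4] [0, 6, 7, 5, 8],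
           Cycles [1, 2, 3, 4] [0, 7, 5, 6, 8], Cycles [1, 2, 3, 4] [7, 5, 8, 0, 9], Outs 0 [1, 3]])
        (Split [] 3 9
         (Close [Cycles [2, 0, 1, 4] [7, 5, 6, 3, 9], Cycles [0, 1, 2, 4] [7, 5, 6, 3, 9]])
         (Split [] 5 4
          (Split [] 3 8
           (Close [Cycles [1, 2, 3, 8] [5, 4, 0, 6, 7], Cycles [5, 4, 6, 7] [0, 1, 2, 3, 8],
              Cycles [1, 2, 3, 8] [7, 5, 4, 0, 9], Cycles [1, 2, 3, 8] [5, 6, 4, 0, 7],
              Cycles [5, 6, 4, 7] [0, 1, 2, 3, 8], Outs 0 [1, 3],
              Cycles [1, 2, 3, 8] [4, 0, 5, 6, 7]])
           (Split [] 7 3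
            (Split [Sinks [4, 0, 1, 2, 5] [3, 8]] 3 5
             (Close [Cycles [2, 0, 1, 4] [3, 5, 6, 7, 8], Cycles [0, 1, 2, 4] [3, 5, 6, 7, 8]])
             (Split [Outs 3 [1, 4], Outs 3 [0, 4], Cycles [0, 1, 2, 3] [6, 7, 5, 4, 9]] 8 4
              (Close [Cycles [0, 1, 2, 3] [4, 6, 7, 5, 8], Cycles [0, 1, 2, 3] [4, 7, 5, 6, 8],
                 Outs 4 [0, 2]])
              (Close [Cycles [3, 1, 4, 8] [5, 2, 0, 6, 7], Cycles [5, 2, 6, 7] [3, 0, 1, 4, 8],
                 Cycles [3, 1, 4, 8] [7, 5, 2, 0, 9], Outs 0 [1, 5],
                 Sinks [1, 4, 0, 7, 8] [3, 2]])))
            (Close [Cycles [2, 0, 1, 4] [3, 7, 5, 6, 8], Cycles [0, 1, 2, 4] [3, 7, 5, 6, 8]])))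
          (Split [Cycles [3, 4, 5, 6] [1, 2, 0, 7, 8], Cycles [3, 4, 5, 6] [0, 1, 2, 7, 8],
             Cycles [3, 4, 5, 6] [8, 1, 2, 0, 9]] 0 3
           (Close [Sinks [1, 4, 5, 6, 8] [3, 0], Cycles [2, 0, 3, 7] [1, 4, 5, 6, 8]])
           (Close [Outs 0 [1, 5], Cycles [1, 4, 5, 8] [2, 3, 0, 6, 7]])))))
       (Split [Cycles [0, 2, 3, 4] [1, 5, 6, 7, 8], Cycles [0, 2, 3, 4] [1, 6, 7, 5, 8],
          Cycles [0, 2, 3, 4] [1, 7, 5, 6, 8], Cycles [0, 2, 3, 4] [7, 5, 8, 1, 9], Outs 1 [2, 4],
          Outs 1 [2, 3], Sinks [3, 4, 0, 2, 6] [1, 8], Sinks [2, 3, 4, 0, 6] [1, 8],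
          Sinks [0, 2, 3, 4, 6] [1, 8]] 2 8
        (Close [Cycles [5, 6, 3, 7] [1, 4, 0, 2, 8], Cycles [0, 1, 2, 8] [5, 6, 3, 4, 7],
           Cycles [5, 6, 3, 9] [1, 4, 0, 2, 8], Cycles [0, 1, 2, 8] [5, 6, 3, 4, 9],
           Cycles [3, 5, 6, 7] [1, 4, 0, 2, 8], Cycles [0, 1, 2, 8] [3, 4, 5, 6, 7], Outs 3 [0, 4],
           Outs 4 [0, 2], Outs 8 [0, 1]])
        (Close [Cycles [0, 1, 3, 4] [2, 5, 6, 7, 8], Cycles [0, 1, 3, 4] [2, 7, 5, 6, 8],
           Outs 2 [3, 4]])))
      (Split [Cycles [8, 1, 2, 9] [3, 4, 0, 5, 6], Cycles [3, 4, 5, 6] [7, 8, 1, 2, 9],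
         Cycles [3, 4, 0, 6] [7, 8, 1, 2, 9], Cycles [5, 6, 3, 7] [8, 0, 1, 2, 9],
         Cycles [8, 1, 2, 9] [5, 6, 3, 4, 7], Cycles [3, 5, 6, 7] [8, 0, 1, 2, 9],
         Cycles [3, 4, 6, 7] [8, 0, 1, 2, 9], Cycles [3, 4, 0, 7] [5, 8, 1, 2, 9]] 2 6
       (Close [Cycles [7, 5, 3, 9] [0, 1, 2, 6, 8], Cycles [1, 2, 6, 8] [7, 5, 3, 4, 9],
          Sinks [0, 1, 2, 6, 8] [4, 3]])
       (Split [Cycles [0, 1, 3, 4] [7, 5, 6, 2, 9], Cycles [5, 6, 2, 9] [3, 4, 0, 1, 7]] 4 1
        (Close [Cycles [1, 2, 3, 4] [7, 5, 8, 0, 9], Outs 0 [1, 3], Sinks [2, 3, 4, 1, 6] [0, 8],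
           Cycles [0, 2, 3, 4] [5, 6, 7, 1, 9], Outs 1 [2, 5]])
        (Close [Cycles [0, 3, 1, 4] [7, 5, 6, 2, 9], Cycles [0, 1, 4, 8] [7, 5, 6, 2, 9],
           Cycles [0, 1, 2, 3] [7, 5, 6, 4, 9], Outs 4 [0, 2]]))))"

definition sink_triangle_certificate :: certificate where
  "sink_triangle_certificate =
    Split [] 7 4
     (Split [] 6 2
      (Split [] 3 5
       (Split [Cycles [2, 3, 5, 6] [7, 4, 0, 1, 8], Cycles [6, 7, 4, 8] [0, 1, 2, 3, 5],
          Sinks [0, 1, 2, 3, 5] [4]] 4 1
        (Close [Sinks [2, 3, 5, 6, 7] [1], Sinks [5, 6, 2, 3, 7] [1], Sinks [3, 5, 6, 2, 7] [1]])
        (Close [Sinks [2, 0, 1, 4, 6] [5], Sinks [2, 3, 5, 0, 6] [4], Sinks [0, 2, 3, 5, 6] [4]]))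
       (Split [] 7 2
        (Split [] 1 5
         (Close [Sinks [3, 4, 0, 1, 5] [2], Cycles [6, 7, 2, 8] [3, 4, 0, 1, 5]])
         (Split [] 4 6
          (Close [Sinks [2, 3, 4, 6, 7] [1], Cycles [2, 3, 4, 6] [7, 5, 0, 1, 8]])
          (Split [] 6 1
           (Split [] 7 0
            (Split [] 6 0
             (Split [] 5 4
              (Split [] 4 8
               (Split [Cycles [0, 1, 2, 3] [6, 7, 5, 4, 8], Cycles [7, 5, 4, 8] [0, 1, 2, 3, 6],
                  Cycles [5, 0, 1, 7] [6, 2, 3, 4, 8], Cycles [5, 6, 4, 8] [0, 1, 2, 3, 7],
                  Cycles [7, 3, 4, 8] [0, 1, 2, 5, 6]] 1 3
                (Close [Cycles [0, 1, 3, 4] [6, 7, 5, 2, 8], Outs 2 [0, 3],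
                   Cycles [0, 1, 2, 4] [5, 6, 7, 3, 8], Outs 3 [2, 4]])
                (Close [Cycles [1, 2, 0, 3] [5, 6, 7, 4, 8], Cycles [0, 2, 3, 4] [6, 7, 5, 1, 8],
                   Outs 1 [2, 4]]))
               (Close [Outs 4 [0, 2], Cycles [1, 2, 3, 4] [7, 5, 6, 0, 8], Outs 0 [1, 3],
                  Sinks [2, 3, 4, 1, 7] [0], Cycles [0, 2, 3, 4] [7, 5, 6, 1, 8], Outs 1 [2, 3]]))
              (Close [Sinks [1, 2, 3, 4, 5] [0], Cycles [6, 7, 0, 8] [1, 2, 3, 4, 5]]))
             (Close [Cycles [7, 5, 1, 8] [2, 3, 4, 0, 6], Cycles [4, 0, 6, 7] [5, 1, 2, 3, 8],
                Sinks [2, 3, 4, 0, 6] [1], Sinks [4, 0, 6, 1, 7] [3]]))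
            (Close [Sinks [2, 3, 4, 0, 7] [1], Cycles [5, 6, 1, 8] [2, 3, 4, 0, 7]]))
           (Close [Sinks [4, 0, 1, 6, 7] [3], Cycles [4, 0, 1, 6] [7, 5, 2, 3, 8],
              Cycles [4, 0, 1, 6] [7, 2, 5, 3, 8]]))))
        (Close [Sinks [4, 0, 1, 2, 7] [6], Sinks [4, 0, 1, 2, 7] [3],
           Cycles [5, 6, 3, 8] [4, 0, 1, 2, 7]])))
      (Split [] 8 4
       (Split [] 5 2
        (Split [] 8 1
         (Split [] 1 3
          (Close [Sinks [4, 0, 1, 3, 7] [6], Cycles [5, 2, 6, 7] [1, 3, 4, 0, 8],
             Sinks [3, 4, 0, 1, 7] [6], Sinks [1, 2, 3, 6, 7] [0], Sinks [1, 3, 4, 0, 7] [6],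
             Sinks [0, 1, 2, 6, 7] [4], Sinks [3, 4, 5, 2, 6] [1]])
          (Close [Sinks [4, 5, 2, 6, 7] [1], Sinks [5, 4, 2, 6, 7] [1], Outs 4 [0, 1],
             Sinks [5, 2, 4, 6, 7] [1]]))
         (Close [Cycles [5, 2, 6, 7] [3, 4, 0, 1, 8], Cycles [4, 0, 1, 8] [5, 2, 3, 6, 7],
            Cycles [3, 4, 2, 6] [7, 5, 0, 1, 8], Cycles [0, 1, 2, 4] [7, 5, 6, 3, 8]]))
        (Close [Sinks [0, 1, 2, 5, 6] [4], Sinks [1, 2, 5, 0, 6] [4], Sinks [3, 4, 0, 1, 6] [5],
           Outs 6 [4, 7]]))
       (Close [Cycles [0, 1, 2, 3] [5, 6, 7, 4, 8], Cycles [1, 2, 6, 7] [5, 0, 3, 4, 8],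
          Sinks [4, 0, 3, 1, 7] [6], Sinks [3, 4, 0, 1, 7] [6], Sinks [4, 0, 1, 3, 7] [6]])))
     (Split [Sinks [0, 1, 2, 3, 5] [7]] 1 7
      (Split [] 7 3
       (Close [Sinks [3, 4, 0, 1, 7] [6], Cycles [5, 6, 2, 8] [3, 4, 0, 1, 7],
          Sinks [3, 4, 0, 1, 7] [2], Sinks [5, 0, 3, 4, 7] [2], Sinks [3, 0, 1, 2, 5] [7]])
       (Close [Outs 7 [2, 5], Outs 7 [0, 5], Sinks [0, 1, 2, 3, 7] [6],
          Cycles [5, 6, 4, 8] [0, 1, 2, 3, 7], Sinks [0, 1, 2, 3, 7] [4], Sinks [2, 5, 0, 1, 7] [4],
          Sinks [5, 2, 0, 1, 7] [4], Sinks [0, 2, 3, 4, 5] [7]]))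
      (Close [Sinks [1, 2, 3, 4, 7] [6], Sinks [1, 2, 3, 4, 7] [0],
         Cycles [5, 6, 0, 8] [1, 2, 3, 4, 7]]))"

lemma certifies_two_sinks: "certifies 9 {} two_sinks_arcs two_sinks_certificate"
  by code_simp

lemma certifies_sink_vertex: "certifies 9 {2} sink_vertex_arcs sink_vertex_certificate"
  by code_simp

lemma certifies_sink_triangle: "certifies 8 {1} sink_triangle_arcs sink_triangle_certificate"
  by code_simp

lemma exists_other_element:
  assumes "2 \<le> card A"
  obtains x where "x \<in> A" "x \<noteq> y"
proof -
  have "\<not> A \<subseteq> {y}"
    using assms card_mono[of "{y}" A] by auto
  then show thesis
    using that by blast
qed

locale large_strong_subtournament = subtournament_outdeg_3 +
  assumes strong_K: "strong E K"
    and card_K: "9 \<le> card K"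
begin

lemma card_complement:
  assumes "is_cycle K E S" "length S = 5"
  shows "4 \<le> card (K - set S)"
  using assms card_K finite_K card_set_cycle[OF assms(1)]
  by (simp add: card_Diff_subset is_cycle_def)

lemma entering_arc:
  assumes "is_cycle K E S" "A \<subseteq> K - set S" "A \<noteq> {}" "\<forall>x\<in>K - set S - A. \<forall>a\<in>A. E a x"
  obtains s S' p where "is_cycle K E (s # S')" "length (s # S') = length S"
    "set (s # S') = set S" "p \<in> A" "E s p"
proof -
  have "set S \<subseteq> K - A" "set S \<noteq> {}"
    using assms(1,2) by (auto simp: is_cycle_def)
  then have "K - A \<noteq> {}"
    by (metis subset_empty)
  moreover have "K - (K - A) = A"
    using assms(2) by auto
  moreover from this have "K - A \<subset> K"
    using assms(3) by auto
  ultimately obtain s p where sp: "s \<in> K - A" "p \<in> A" "E s p"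
    using strong_leave[OF strong_K, of "K - A"] by auto
  then have "s \<in> set S"
    using assms(4) arc_asym by blast
  then obtain S' where "is_cycle K E (s # S')" "length (s # S') = length S" "set (s # S') = set S"
    using cycle_starting_at[OF assms(1)] by metis
  then show thesis
    using sp by (intro that[of s S' p]) auto
qed

lemma entering_path:
  assumes S: "is_cycle K E S" and A: "A \<subseteq> K - set S" "2 \<le> card A"
    and below: "\<forall>x\<in>K - set S - A. \<forall>a\<in>A. E a x"
  obtains s S' p w where "is_cycle K E (s # S')" "length (s # S') = length S"
    "set (s # S') = set S" "p \<in> A" "w \<in> A" "E s p" "E p w"
proof (cases "\<exists>w\<in>A. \<forall>x\<in>A - {w}. E x w")
  case True
  then obtain w where w: "w \<in> A" "\<forall>x\<in>A - {w}. E x w" ..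
  have "A - {w} \<subseteq> K - set S" "A - {w} \<noteq> {}"
    using A(1) exists_other_element[OF A(2), of w] by blast+
  moreover have "\<forall>x\<in>K - set S - (A - {w}). \<forall>a\<in>A - {w}. E a x"
    using below w by blast
  ultimately obtain s S' p where "is_cycle K E (s # S')" "length (s # S') = length S"
      "set (s # S') = set S" "p \<in> A - {w}" "E s p"
    by (rule entering_arc[OF S])
  then show ?thesis
    using w by (intro that[of s S' p w]) auto
next
  case False
  have "A \<noteq> {}"
    using exists_other_element[OF A(2)] by blast
  then obtain s S' p where p: "is_cycle K E (s # S')" "length (s # S') = length S"
      "set (s # S') = set S" "p \<in> A" "E s p"
    using below by (rule entering_arc[OF S A(1)])
  then obtain w where "w \<in> A" "w \<noteq> p" "\<not> E w p"
    using False by blast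
  then have "E p w"
    using p(4) A(1) K_subset_V arc_total[of p w] by blast
  then show ?thesis
    using p \<open>w \<in> A\<close> by (intro that[of s S' p w])
qed

lemma disjoint_cycles_of_two_sinks:
  assumes "is_cycle K E S" "length S = 5" "length ys = 2" "successive_sinks E (K - set S) ys"
  shows "disjoint_cycles_4_5 K E"
proof -
  let ?X = "K - set S"
  obtain y z where "ys = [y, z]"
    using assms(3) by (auto simp: numeral_2_eq_2 length_Suc_conv)
  then have y: "y \<in> ?X" "\<forall>x\<in>?X - {y}. E x y"
    and z: "z \<in> ?X" "z \<noteq> y" "\<forall>x\<in>?X - {y, z}. E x z"
    using assms(4) by auto
  have "card (?X - {y, z}) = card ?X - 2"
    using y z finite_K by (simp add: card_Diff_subset)
  then have "?X - {y, z} \<subseteq> ?X" "2 \<le> card (?X - {y, z})"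
    using card_complement[OF assms(1,2)] by auto
  moreover have "\<forall>x\<in>?X - (?X - {y, z}). \<forall>a\<in>?X - {y, z}. E a x"
    using y z by blast
  ultimately obtain s S' p w where
    S': "is_cycle K E (s # S')" "length (s # S') = length S" "set (s # S') = set S"
    and pw: "p \<in> ?X - {y, z}" "w \<in> ?X - {y, z}" "E s p" "E p w"
    by (rule entering_path[OF assms(1)])
  obtain b c d e where S'_eq: "S' = [b, c, d, e]"
    using S'(2) assms(2) by (auto simp: length_Suc_conv numeral_eq_Suc)
  interpret indexed_parts V E K "[s, b, c, d, e, p, w, z, y]" "{}"
    using S' S'_eq y z pw arc_irrefl by unfold_locales (auto simp: is_cycle_iff_successively)
  have "\<forall>a\<in>set two_sinks_arcs. part_arc a"
    using S' S'_eq y z pw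
    by (auto simp: two_sinks_arcs_def cycle_arcs_def part_arc_def part_def
        is_cycle_iff_successively)
  then show ?thesis
    by (rule certificate_sound) (use certifies_two_sinks in \<open>simp add: numeral_eq_Suc\<close>)
qed

lemma disjoint_cycles_or_sink:
  assumes "is_cycle K E S" "length S = 5" "A \<subseteq> K - set S" "A \<noteq> {}"
  obtains "disjoint_cycles_4_5 K E"
  | y where "y \<in> A" "\<forall>x\<in>A - {y}. E x y"
  | T where "is_cycle A E T" "length T = 3" "\<forall>x\<in>A - set T. \<forall>t\<in>set T. E x t"
proof (cases "\<exists>c. is_cycle A E c \<and> length c = 4")
  case True
  then obtain c where c: "is_cycle A E c" "length c = 4"
    by blast
  then have "is_cycle K E c" "set c \<inter> set S = {}"
    using assms(3) by (auto simp: is_cycle_def)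
  then show ?thesis
    using disjoint_cycles_4_5I[of K E c S] c(2) assms(1,2) that(1) by blast
next
  case False
  moreover have "A \<subseteq> V"
    using assms(3) K_subset_V by blast
  ultimately show ?thesis
    using sink_vertex_or_sink_triangle[of A thesis] assms(4) that(2,3) by blast
qed

lemma disjoint_cycles_of_sink_vertex_below_triangle:
  assumes "is_cycle K E S" "length S = 5"
    and y: "y \<in> K - set S" "\<forall>x\<in>K - set S - {y}. E x y"
    and T: "is_cycle (K - set S - {y}) E T" "length T = 3"
      "\<forall>x\<in>K - set S - {y} - set T. \<forall>t\<in>set T. E x t"
  shows "disjoint_cycles_4_5 K E"
proof -
  let ?N = "{w \<in> K. E y w}"
  have "?N \<subseteq> set S"
    using y arc_asym arc_irrefl by blast
  moreover have "length S < 2 * card ?N"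
    using outdeg_ge_3[of y] y(1) assms(2) by (simp add: outdeg_def)
  moreover have "distinct S"
    using assms(1) by (simp add: is_cycle_def)
  ultimately obtain a b where ab: "(a, b) \<in> set (cycle_arcs S)" "a \<in> ?N" "b \<in> ?N"
    using majority_contains_arc[of S ?N] by blast
  obtain S' where S': "is_cycle K E (a # b # S')" "length (a # b # S') = length S"
      "set (a # b # S') = set S"
    using cycle_starting_with_arc[OF assms(1) ab(1)] by metis
  obtain c d e where S'_eq: "S' = [c, d, e]"
    using S'(2) assms(2) by (auto simp: length_Suc_conv numeral_eq_Suc)
  obtain t u v where T_eq: "T = [t, u, v]"
    using T(2) by (auto simp: length_Suc_conv numeral_eq_Suc)
  interpret indexed_parts V E K "[a, b, c, d, e, t, u, v, y]" "{2}"
    using S' S'_eq T(1) T_eq y disjoint_cycles_of_two_sinks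
    by unfold_locales (auto simp: is_cycle_iff_successively)
  have "\<forall>a\<in>set sink_vertex_arcs. part_arc a"
    using S' S'_eq T(1,3) T_eq y ab
    by (auto simp: sink_vertex_arcs_def cycle_arcs_def part_arc_def part_def
        is_cycle_iff_successively)
  then show ?thesis
    by (rule certificate_sound) (use certifies_sink_vertex in \<open>simp add: numeral_eq_Suc\<close>)
qed

lemma disjoint_cycles_of_sink_vertex:
  assumes "is_cycle K E S" "length S = 5" "length ys = 1" "successive_sinks E (K - set S) ys"
  shows "disjoint_cycles_4_5 K E"
proof -
  let ?X = "K - set S"
  obtain y where "ys = [y]"
    using assms(3) by (auto simp: length_Suc_conv)
  then have y: "y \<in> ?X" "\<forall>x\<in>?X - {y}. E x y"
    using assms(4) by auto
  have "2 \<le> card ?X"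
    using card_complement[OF assms(1,2)] by simp
  then have "?X - {y} \<noteq> {}"
    using exists_other_element[of ?X y] by blast
  then consider (disjoint) "disjoint_cycles_4_5 K E"
    | (vertex) z where "z \<in> ?X - {y}" "\<forall>x\<in>?X - {y} - {z}. E x z"
    | (triangle) T where "is_cycle (?X - {y}) E T" "length T = 3"
        "\<forall>x\<in>?X - {y} - set T. \<forall>t\<in>set T. E x t"
    by (rule disjoint_cycles_or_sink[OF assms(1,2) Diff_subset])
  then show ?thesis
  proof cases
    case vertex
    then have "successive_sinks E ?X [y, z]"
      using y by simp
    then show ?thesis
      using disjoint_cycles_of_two_sinks[OF assms(1,2), of "[y, z]"] by simp
  next
    case triangle
    then show ?thesis
      using disjoint_cycles_of_sink_vertex_below_triangle[OF assms(1,2) y] by blast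
  qed
qed

lemma disjoint_cycles_of_sink_triangle:
  assumes "is_cycle K E S" "length S = 5" and T: "is_cycle (K - set S) E T" "length T = 3"
    and sink: "\<forall>x\<in>K - set S - set T. \<forall>t\<in>set T. E x t"
  shows "disjoint_cycles_4_5 K E"
proof -
  obtain t u v where T_eq: "T = [t, u, v]"
    using T(2) by (auto simp: length_Suc_conv numeral_eq_Suc)
  have "\<exists>a\<in>set S. E t a"
  proof (rule ccontr)
    assume "\<not> ?thesis"
    then have "{w \<in> K. E t w} \<subseteq> {u}"
      using sink T(1) arc_asym arc_irrefl by (auto simp: T_eq is_cycle_iff_successively)
    then have "outdeg K E t \<le> 1"
      unfolding outdeg_def using card_mono[of "{u}"] by fastforce
    moreover have "t \<in> K"
      using T(1) by (auto simp: T_eq is_cycle_def)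
    ultimately show False
      using outdeg_ge_3[of t] by simp
  qed
  then obtain a where a: "a \<in> set S" "E t a" ..
  then obtain S' where S': "is_cycle K E (a # S')" "length (a # S') = length S"
      "set (a # S') = set S"
    using cycle_starting_at[OF assms(1)] by metis
  obtain b c d e where S'_eq: "S' = [b, c, d, e]"
    using S'(2) assms(2) by (auto simp: length_Suc_conv numeral_eq_Suc)
  interpret indexed_parts V E K "[a, b, c, d, e, t, u, v]" "{1}"
    using S' S'_eq T(1) T_eq disjoint_cycles_of_sink_vertex
    by unfold_locales (auto simp: is_cycle_iff_successively)
  have "\<forall>a\<in>set sink_triangle_arcs. part_arc a"
    using S' S'_eq T(1) T_eq sink a
    by (auto simp: sink_triangle_arcs_def cycle_arcs_def part_arc_def part_def
        is_cycle_iff_successively)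
  then show ?thesis
    by (rule certificate_sound) (use certifies_sink_triangle in \<open>simp add: numeral_eq_Suc\<close>)
qed

theorem disjoint_cycles: "disjoint_cycles_4_5 K E"
proof -
  obtain S where S: "is_cycle K E S" "length S = 5"
    using strong_cycle_of_length[OF strong_K K_subset_V, of 5] card_K by auto
  have "K - set S \<noteq> {}"
    using card_complement[OF S] by (metis card.empty not_numeral_le_zero)
  then consider (disjoint) "disjoint_cycles_4_5 K E"
    | (vertex) y where "y \<in> K - set S" "\<forall>x\<in>K - set S - {y}. E x y"
    | (triangle) T where "is_cycle (K - set S) E T" "length T = 3"
        "\<forall>x\<in>K - set S - set T. \<forall>t\<in>set T. E x t"
    by (rule disjoint_cycles_or_sink[OF S subset_refl])
  then show ?thesis
  proof cases
    case vertex
    then show ?thesis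
      using disjoint_cycles_of_sink_vertex[OF S, of "[y]"] by simp
  next
    case triangle
    then show ?thesis
      using disjoint_cycles_of_sink_triangle[OF S] by blast
  qed
qed

end

section \<open>Sink components with at most eight vertices\<close>

lemma exists_distinct_representatives:
  assumes "1 \<le> card A" "1 \<le> card B" "2 \<le> card A \<or> 2 \<le> card B"
  obtains x y where "x \<in> A" "y \<in> B" "x \<noteq> y"
proof -
  have "A \<noteq> {}" "B \<noteq> {}"
    using assms(1,2) by auto
  then obtain a b where "a \<in> A" "b \<in> B"
    by blast
  then show thesis
    using assms(3) exists_other_element[of A b] exists_other_element[of B a] that by metis
qed

lemma exists_le_of_sum_less:
  fixes f :: "'a \<Rightarrow> nat"
  assumes "sum f A < card A * Suc m"
  obtains a where "a \<in> A" "f a \<le> m"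
proof (rule ccontr)
  assume "\<not> thesis"
  then have "\<And>a. a \<in> A \<Longrightarrow> Suc m \<le> f a"
    using that by fastforce
  then have "card A * Suc m \<le> sum f A"
    using sum_bounded_below[of A "Suc m" f] by simp
  then show False
    using assms by simp
qed

lemma three_disjoint_cycles_diff_lengthsI:
  assumes "is_cycle V E c" "is_cycle V E d" "is_cycle V E e"
    and "length c = 3" "length d = 4" "length e = 5"
    and "set c \<inter> set d = {}" "set c \<inter> set e = {}" "set d \<inter> set e = {}"
  shows "three_disjoint_cycles_diff_lengths V E"
  unfolding three_disjoint_cycles_diff_lengths_def
  using assms by (intro exI[of _ c] exI[of _ d] exI[of _ e]) simp

locale small_sink_component = tournament_graph +
  fixes T :: "'a list" and K :: "'a set"
  assumes outdeg_ge_6: "v \<in> V \<Longrightarrow> 6 \<le> outdeg V E v"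
    and triangle: "is_cycle V E T" "length T = 3"
    and component: "K \<subseteq> V - set T" "strong E K" "card K \<le> 8"
    and rest_dominates: "x \<in> V - set T - K \<Longrightarrow> k \<in> K \<Longrightarrow> E x k"
begin

definition U :: "'a set" where
  "U = V - set T - K"

lemma subsets_V: "set T \<subseteq> V" "K \<subseteq> V" "U \<subseteq> V"
  and disjoint: "set T \<inter> K = {}" "set T \<inter> U = {}" "K \<inter> U = {}"
  using triangle(1) component(1) by (auto simp: U_def is_cycle_def)

lemma U_dominates: "u \<in> U \<Longrightarrow> k \<in> K \<Longrightarrow> E u k"
  using rest_dominates by (simp add: U_def)

lemma outdeg_plus_indeg_T: "k \<in> K \<Longrightarrow> outdeg (set T) E k + indeg (set T) E k = 3"
  using outdeg_plus_indeg[of "set T" k] card_set_cycle[OF triangle(1)] triangle(2)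
    subsets_V disjoint
  by auto

lemma inner_outdeg:
  assumes "k \<in> K"
  shows "3 + indeg (set T) E k \<le> outdeg K E k"
proof -
  have "outdeg V E k \<le> outdeg K E k + outdeg (set T) E k"
    using subsets_V(1,2) rest_dominates assms by (intro outdeg_le_sink_component)
  then show ?thesis
    using outdeg_ge_6[of k] outdeg_plus_indeg_T[OF assms] assms subsets_V(2) by auto
qed

lemma card_K_cases:
  "card K = 7 \<and> sum (indeg (set T) E) K = 0 \<or> card K = 8 \<and> sum (indeg (set T) E) K \<le> 4"
proof -
  have "(\<Sum>k\<in>K. 3 + indeg (set T) E k) \<le> (\<Sum>k\<in>K. outdeg K E k)"
    by (intro sum_mono inner_outdeg)
  then have "6 * card K + 2 * sum (indeg (set T) E) K \<le> card K * (card K - 1)"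
    using sum_outdeg[OF subsets_V(2)] by (simp add: sum.distrib)
  moreover have "card K \<noteq> 0"
    using component(2) finite_subset_V[OF subsets_V(2)] by (simp add: strong_def)
  moreover have "card K \<in> {0, 1, 2, 3, 4, 5, 6, 7, 8}"
    using component(3) by (simp add: le_Suc_eq numeral_eq_Suc)
  ultimately show ?thesis
    by (elim insertE) auto
qed

lemma two_arcs_to_T:
  assumes "R \<subseteq> K" "card R = card K - 5"
  obtains k l x y where "k \<in> R" "l \<in> R" "k \<noteq> l" "x \<in> set T" "y \<in> set T" "x \<noteq> y" "E k x" "E l y"
proof -
  let ?in = "indeg (set T) E"
  have fin: "finite K" "finite R"
    using finite_subset_V[OF subsets_V(2)] assms(1) finite_subset by blast+
  have sum_R: "sum ?in R \<le> sum ?in K"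
    using assms(1) fin by (intro sum_mono2) auto
  then have "sum ?in R < card R * Suc 1"
    using card_K_cases assms(2) by auto
  then obtain k where k: "k \<in> R" "?in k \<le> 1"
    by (rule exists_le_of_sum_less)
  have "sum ?in (R - {k}) \<le> sum ?in R"
    using fin by (intro sum_mono2) auto
  then have "sum ?in (R - {k}) < card (R - {k}) * Suc 2"
    using sum_R card_K_cases assms(2) k(1) by auto
  then obtain l where l: "l \<in> R - {k}" "?in l \<le> 2"
    by (rule exists_le_of_sum_less)
  have "2 \<le> outdeg (set T) E k" "1 \<le> outdeg (set T) E l"
    using outdeg_plus_indeg_T[of k] outdeg_plus_indeg_T[of l] k l assms(1) by auto
  then obtain x y where "x \<in> {t \<in> set T. E k t}" "y \<in> {t \<in> set T. E l t}" "x \<noteq> y"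
    unfolding outdeg_def
    using exists_distinct_representatives[of "{t \<in> set T. E k t}" "{t \<in> set T. E l t}"] by auto
  then show thesis
    using k(1) l(1) by (intro that[of k l x y]) auto
qed

lemma triangle_containing_arc:
  assumes "a \<in> set T" "c \<in> set T" "E c a"
  obtains b where "is_cycle V E [c, a, b]" "set [c, a, b] = set T"
proof -
  obtain T' where T': "is_cycle V E (c # T')" "length (c # T') = 3" "set (c # T') = set T"
    using cycle_starting_at[OF triangle(1) assms(2)] triangle(2) by metis
  then obtain p q where pq: "T' = [p, q]"
    by (auto simp: length_Suc_conv numeral_eq_Suc)
  then have "E q c" "a \<in> {c, p, q}"
    using T' assms(1) by (auto simp: is_cycle_iff_successively)
  then have "a = p"
    using assms(3) arc_asym arc_irrefl by blast
  with T' pq show thesis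
    using that by blast
qed

lemma triangle_with_entering_arcs:
  assumes "R \<subseteq> K" "card R = card K - 5"
  obtains a b c l m where "is_cycle V E [c, a, b]" "set [c, a, b] = set T"
    "l \<in> R" "m \<in> R" "l \<noteq> m" "E l a" "E m c"
proof -
  obtain k l x y where arcs_to_T: "k \<in> R" "l \<in> R" "k \<noteq> l" "E k x" "E l y"
    and xy: "x \<in> set T" "y \<in> set T" "x \<noteq> y"
    using assms by (rule two_arcs_to_T)
  from xy consider (forward) "E x y" | (backward) "E y x"
    using arc_total[of x y] subsets_V(1) by blast
  then show thesis
  proof cases
    case forward
    then obtain b where "is_cycle V E [x, y, b]" "set [x, y, b] = set T"
      using triangle_containing_arc xy by blast
    then show ?thesis
      using that[of x y b l k] arcs_to_T by blast
  next
    case backward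
    then obtain b where "is_cycle V E [y, x, b]" "set [y, x, b] = set T"
      using triangle_containing_arc xy by blast
    then show ?thesis
      using that[of y x b k l] arcs_to_T by blast
  qed
qed

lemma outdeg_outside_T:
  assumes "v \<in> set T" "{w \<in> set T. E v w} \<subseteq> {t}"
  shows "5 \<le> outdeg K E v + outdeg U E v"
proof -
  have "{w \<in> V. E v w} \<subseteq> insert t ({k \<in> K. E v k} \<union> {u \<in> U. E v u})"
    using assms(2) by (auto simp: U_def)
  moreover have "finite K" "finite U"
    using subsets_V finite_subset_V by blast+
  ultimately have "outdeg V E v \<le> card (insert t ({k \<in> K. E v k} \<union> {u \<in> U. E v u}))"
    unfolding outdeg_def by (intro card_mono) auto
  also have "\<dots> \<le> Suc (card ({k \<in> K. E v k} \<union> {u \<in> U. E v u}))"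
    by (rule card_insert_le_m1) auto
  also have "\<dots> \<le> Suc (outdeg K E v + outdeg U E v)"
    by (simp add: outdeg_def card_Un_le)
  finally show ?thesis
    using outdeg_ge_6[of v] assms(1) subsets_V(1) by auto
qed

lemma two_arcs_to_U:
  assumes T: "is_cycle V E [c, a, b]" "set [c, a, b] = set T"
  obtains u u' where "u \<in> U" "u' \<in> U" "u \<noteq> u'" "E b u" "E c u'"
proof -
  have "outdeg K E a + outdeg K E b + outdeg K E c = (\<Sum>t\<in>set [c, a, b]. outdeg K E t)"
    using T(1) by (simp add: is_cycle_def)
  also have "\<dots> = sum (indeg (set T) E) K"
    using sum_outdeg_eq_sum_indeg[OF subsets_V(1,2)] unfolding T(2) .
  finally have "outdeg K E b + outdeg K E c \<le> 4"
    using card_K_cases by linarith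
  moreover have "5 \<le> outdeg K E b + outdeg U E b"
    by (rule outdeg_outside_T[of b c])
      (use T(1) arc_asym arc_irrefl in \<open>auto simp: is_cycle_iff_successively simp flip: T(2)\<close>)
  moreover have "5 \<le> outdeg K E c + outdeg U E c"
    by (rule outdeg_outside_T[of c a])
      (use T(1) arc_asym arc_irrefl in \<open>auto simp: is_cycle_iff_successively simp flip: T(2)\<close>)
  ultimately have "1 \<le> outdeg U E b" "1 \<le> outdeg U E c" "2 \<le> outdeg U E b \<or> 2 \<le> outdeg U E c"
    by linarith+
  then obtain u u' where "u \<in> {u \<in> U. E b u}" "u' \<in> {u \<in> U. E c u}" "u \<noteq> u'"
    unfolding outdeg_def by (rule exists_distinct_representatives)
  then show thesis
    by (intro that[of u u']) auto
qed

theorem three_disjoint_cycles: "three_disjoint_cycles_diff_lengths V E"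
proof -
  have "5 \<le> card K"
    using card_K_cases by auto
  then obtain C where C: "is_cycle K E C" "length C = 5"
    using strong_cycle_of_length[OF component(2) subsets_V(2), of 5] by auto
  then have C_K: "set C \<subseteq> K"
    by (simp add: is_cycle_def)
  then have "card (K - set C) = card K - 5"
    using card_set_cycle[OF C(1)] C(2) by (simp add: card_Diff_subset)
  then obtain a b c l m where T: "is_cycle V E [c, a, b]" "set [c, a, b] = set T"
    and lm: "l \<in> K - set C" "m \<in> K - set C" "l \<noteq> m" "E l a" "E m c"
    using triangle_with_entering_arcs[OF Diff_subset] by metis
  obtain u u' where u: "u \<in> U" "u' \<in> U" "u \<noteq> u'" "E b u" "E c u'"
    using T by (rule two_arcs_to_U)
  have U_K: "E u l" "E u' m"
    using u lm U_dominates by blast+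
  have abc: "a \<in> set T" "b \<in> set T" "c \<in> set T" "distinct [a, b, c]" "E a b"
    using T by (auto simp: is_cycle_iff_successively)
  have "is_cycle V E [c, u', m]" "is_cycle V E [a, b, u, l]"
    using abc u lm U_K subsets_V disjoint by (auto simp: is_cycle_iff_successively)
  moreover have "is_cycle V E C"
    using C(1) subsets_V(2) by (rule is_cycle_mono)
  moreover have "set [c, u', m] \<inter> set [a, b, u, l] = {}"
    using abc u lm disjoint by auto
  moreover have "set [c, u', m] \<inter> set C = {}" "set [a, b, u, l] \<inter> set C = {}"
    using abc u lm C_K disjoint by auto
  ultimately show ?thesis
    using C(2) by (intro three_disjoint_cycles_diff_lengthsI[of V E "[c, u', m]" "[a, b, u, l]" C])
      simp_all
qed

end

section \<open>Tournaments with minimum outdegree 6\<close>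

context tournament_graph
begin

lemma triangle_and_sink_component:
  assumes "\<And>v. v \<in> V \<Longrightarrow> 3 \<le> outdeg V E v"
  obtains T K where "is_cycle V E T" "length T = 3" "K \<subseteq> V - set T" "strong E K"
    "\<And>x k. x \<in> V - set T - K \<Longrightarrow> k \<in> K \<Longrightarrow> E x k"
proof -
  obtain W where W: "W \<subseteq> V" "strong E W" "\<And>w x. w \<in> W \<Longrightarrow> x \<in> V - W \<Longrightarrow> E x w"
    using sink_component[OF subset_refl V_nonempty] by metis
  obtain v where v: "v \<in> W"
    using W(2) strong_nonempty by blast
  then have "{w \<in> V. E v w} \<subseteq> W - {v}"
    using W(3) arc_asym arc_irrefl by blast
  then have "outdeg V E v \<le> card (W - {v})"
    unfolding outdeg_def using finite_subset_V[OF W(1)] by (intro card_mono) auto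
  then have "4 \<le> card W"
    using assms[of v] v W(1) finite_subset_V[OF W(1)] by auto
  then obtain T where T: "is_cycle W E T" "length T = 3"
    using strong_cycle_of_length[OF W(2,1), of 3] by auto
  then have "\<not> W \<subseteq> set T"
    using \<open>4 \<le> card W\<close> card_set_cycle[OF T(1)] card_mono[of "set T" W] by auto
  then have "V - set T \<noteq> {}"
    using W(1) by blast
  then obtain K where "K \<subseteq> V - set T" "strong E K"
      "\<And>k x. k \<in> K \<Longrightarrow> x \<in> V - set T - K \<Longrightarrow> E x k"
    using sink_component[of "V - set T"] by blast
  then show thesis
    using that[of T K] T(2) is_cycle_mono[OF T(1) W(1)] by blast
qed

theorem outdeg_ge_6_three_disjoint_cycles:
  assumes outdeg_ge_6: "\<And>v. v \<in> V \<Longrightarrow> 6 \<le> outdeg V E v"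
  shows "three_disjoint_cycles_diff_lengths V E"
proof -
  have "3 \<le> outdeg V E v" if "v \<in> V" for v
    using outdeg_ge_6[OF that] by simp
  then obtain T K where T: "is_cycle V E T" "length T = 3" and K: "K \<subseteq> V - set T" "strong E K"
    and rest_dominates: "\<And>x k. x \<in> V - set T - K \<Longrightarrow> k \<in> K \<Longrightarrow> E x k"
    using triangle_and_sink_component by metis
  show ?thesis
  proof (cases "card K \<le> 8")
    case True
    interpret small_sink_component V E T K
      using outdeg_ge_6 T K True rest_dominates by unfold_locales
    show ?thesis
      by (rule three_disjoint_cycles)
  next
    case False
    have K_V: "K \<subseteq> V" and T_V: "set T \<subseteq> V" and disjoint: "set T \<inter> K = {}"
      using T(1) K(1) by (auto simp: is_cycle_def)
    have "3 \<le> outdeg K E k" if k: "k \<in> K" for k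
      using outdeg_le_sink_component[OF T_V K_V rest_dominates, of k] outdeg_ge_6[of k] k K_V
        outdeg_le_card[of "set T" E k] card_set_cycle[OF T(1)] T(2) by fastforce
    then interpret large_strong_subtournament V E K
      using K_V K(2) False by unfold_locales auto
    obtain c d where cd: "is_cycle K E c" "is_cycle K E d" "length c = 4" "length d = 5"
      "set c \<inter> set d = {}"
      using disjoint_cycles unfolding disjoint_cycles_4_5_def by blast
    moreover from cd have "set T \<inter> set c = {}" "set T \<inter> set d = {}"
      using disjoint by (auto simp: is_cycle_def)
    ultimately show ?thesis
      using T is_cycle_mono[OF _ K_V]
      by (intro three_disjoint_cycles_diff_lengthsI[of V E T c d]) auto
  qed
qed

end

section \<open>Sharpness\<close>

lemma (in tournament_graph) three_disjoint_cycles_card: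
  assumes "three_disjoint_cycles_diff_lengths V E"
  shows "12 \<le> card V"
proof -
  obtain c1 c2 c3 where c: "is_cycle V E c1" "is_cycle V E c2" "is_cycle V E c3"
    "set c1 \<inter> set c2 = {}" "set c1 \<inter> set c3 = {}" "set c2 \<inter> set c3 = {}"
    "length c1 \<noteq> length c2" "length c1 \<noteq> length c3" "length c2 \<noteq> length c3"
    using assms unfolding three_disjoint_cycles_diff_lengths_def by blast
  have "card (set c1 \<union> set c2 \<union> set c3) = length c1 + length c2 + length c3"
    using c by (simp add: card_Un_disjoint Int_Un_distrib2 card_set_cycle)
  moreover have "card (set c1 \<union> set c2 \<union> set c3) \<le> card V"
    using c(1-3) finite_V by (intro card_mono) (auto simp: is_cycle_def)
  ultimately show ?thesis
    using c(1-3)[THEN length_cycle_ge_3] c(7-9) by linarith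
qed

text \<open>On the residues modulo \<open>2 * k + 1\<close>, the vertex \<open>x\<close> dominates \<open>x + 1, \<dots>, x + k\<close>.\<close>

definition rotational :: "nat \<Rightarrow> nat \<Rightarrow> nat \<Rightarrow> bool" where
  "rotational k x y \<longleftrightarrow> x \<le> 2 * k \<and> y \<le> 2 * k \<and> (x < y \<and> y \<le> x + k \<or> y + k < x)"

lemma tournament_rotational: "tournament {..2 * k} (rotational k)"
  by (auto simp: tournament_def rotational_def)

lemma outdeg_rotational:
  assumes "v \<le> 2 * k"
  shows "outdeg {..2 * k} (rotational k) v = k"
proof -
  have "{w \<in> {..2 * k}. rotational k v w} = {v<..min (v + k) (2 * k)} \<union> {..<v - k}"
    using assms by (auto simp: rotational_def)
  moreover have "{v<..min (v + k) (2 * k)} \<inter> {..<v - k} = {}"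
    by auto
  ultimately have "outdeg {..2 * k} (rotational k) v = (min (v + k) (2 * k) - v) + (v - k)"
    by (simp add: outdeg_def card_Un_disjoint)
  then show ?thesis
    using assms by auto
qed

theorem theorem1p3:
  shows "(\<forall>(V :: 'a set) E. tournament V E \<and> (\<forall>v\<in>V. 6 \<le> outdeg V E v)
            \<longrightarrow> three_disjoint_cycles_diff_lengths V E)
       \<and> (\<exists>(V :: nat set) E. tournament V E \<and> (\<forall>v\<in>V. 5 \<le> outdeg V E v)
            \<and> (\<exists>v\<in>V. outdeg V E v = 5) \<and> \<not> three_disjoint_cycles_diff_lengths V E)"
proof (intro conjI allI impI)
  fix V :: "'a set" and E
  assume min_outdeg: "tournament V E \<and> (\<forall>v\<in>V. 6 \<le> outdeg V E v)"
  then interpret tournament_graph V E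
    by unfold_locales simp
  show "three_disjoint_cycles_diff_lengths V E"
    using outdeg_ge_6_three_disjoint_cycles min_outdeg by simp
next
  let ?V = "{..2 * 5 :: nat}" and ?E = "rotational 5"
  interpret tournament_graph ?V ?E
    by unfold_locales (rule tournament_rotational)
  have "\<not> three_disjoint_cycles_diff_lengths ?V ?E"
    using three_disjoint_cycles_card by auto
  moreover have "\<forall>v\<in>?V. outdeg ?V ?E v = 5"
    using outdeg_rotational[of _ 5] by simp
  ultimately show "\<exists>(V :: nat set) E. tournament V E \<and> (\<forall>v\<in>V. 5 \<le> outdeg V E v)
      \<and> (\<exists>v\<in>V. outdeg V E v = 5) \<and> \<not> three_disjoint_cycles_diff_lengths V E"
    using tournament by (intro exI[of _ ?V] exI[of _ ?E]) auto
qed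

end
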